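(* For each positive integer $\Delta$, there is a constant $c$ such that if $A$ is a rank-$m$ $\Delta$-modular matrix, then the number of distinct rows of $A$ is at most $m^2+c\cdot m$.
   Context: An integer matrix $A$ is $\Delta$-modular if the determinant of each $\mathrm{rank}(A)\times\mathrm{rank}(A)$ submatrix of $A$ has absolute value at most $\Delta$.
   Formalization: The rank m is assumed to be positive: a zero matrix with at least one row has rank 0, is Δ-modular and has one distinct row, while m^2 + c·m = 0, so the claim as worded fails for m = 0. *)

theory Defs
  imports "Jordan_Normal_Form.DL_Rank_Submatrix"
begin

text \<open>The rank of an integer matrix is its rank over the rationals. The library rank of the
  locale \<open>vec_space\<close> is the dimension of the column span, and its dimension parameter is the
  length of the columns, that is, the number of rows.\<close>

definition int_rank :: "int mat \<Rightarrow> nat" where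
  "int_rank A = vec_space.rank (dim_row A) (map_mat rat_of_int A)"

text \<open>A \<open>rank(A) \<times> rank(A)\<close> submatrix is given by sets of row and column indices of that
  cardinality. For rank 0 the only such submatrix is the empty one, with determinant 1.\<close>

definition delta_modular :: "int \<Rightarrow> int mat \<Rightarrow> bool" where
  "delta_modular \<Delta> A \<longleftrightarrow>
    (\<forall>I J. I \<subseteq> {..<dim_row A} \<longrightarrow> J \<subseteq> {..<dim_col A} \<longrightarrow>
       card I = int_rank A \<longrightarrow> card J = int_rank A \<longrightarrow>
       \<bar>det (submatrix A I J)\<bar> \<le> \<Delta>)"

end

theory Submission
  imports Defs
begin

text \<open>The matrix is replaced by the function \<open>d\<close> sending an \<open>m\<close>-tuple of rows to its determinant
  on a column basis. This function is alternating, satisfies the Grassmann-Pluecker exchange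
  relation, and is integer valued with \<open>\<bar>d\<bar> \<le> D\<close>; these properties survive contraction, which
  fixes one entry of the tuple. Let \<open>N\<close> be the number of classes of indistinguishable elements.

  Contracting \<open>e\<close> merges the elements of each line parallel to \<open>e\<close>. Exchanging elements within these
  lines changes \<open>d\<close> by independent nonzero integers, so a circuit of the contraction meets at most
  \<open>4D\<close> of the lines that are merged nontrivially. Hence contracting one element costs at most
  \<open>O(m)\<close> classes.

  If some circuit of bounded size is not unimodular, contracting a bounded set around it decreases
  \<open>D\<close> and costs \<open>O(m)\<close>. Otherwise bounded circuits behave as in a totally unimodular matrix: the
  merged lines have size 2 and are, up to sign, independent in the contraction, so that contracting
  one element costs at most \<open>2m\<close>. Induction on \<open>D\<close> and \<open>m\<close> gives \<open>N \<le> m\<^sup>2 + cm + 1\<close>.\<close>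

section \<open>Grassmann-Pluecker functions and their contractions\<close>

text \<open>Elements with the same signature are indistinguishable for \<open>d\<close>; over a vector space, with \<open>d\<close>
  a determinant, this means equality. The entries of a tuple are indexed by \<open>P\<close> rather than by an
  initial segment so that contraction need not renumber them.\<close>

definition sig :: "nat set \<Rightarrow> ((nat \<Rightarrow> 'a) \<Rightarrow> int) \<Rightarrow> 'a \<Rightarrow> nat \<times> (nat \<Rightarrow> 'a) \<Rightarrow> int" where
  "sig P d x = (\<lambda>(i, f). if i \<in> P then d (f(i := x)) else 0)"

lemma sigD: "sig P d x = sig P d y \<Longrightarrow> i \<in> P \<Longrightarrow> d (f(i := x)) = d (f(i := y))"
  unfolding sig_def by (drule fun_cong[where x = "(i, f)"]) simp

lemma sigI: "(\<And>i f. i \<in> P \<Longrightarrow> d (f(i := x)) = d (f(i := y))) \<Longrightarrow> sig P d x = sig P d y"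
  unfolding sig_def by auto

definition contract :: "nat \<Rightarrow> 'a \<Rightarrow> ((nat \<Rightarrow> 'a) \<Rightarrow> int) \<Rightarrow> (nat \<Rightarrow> 'a) \<Rightarrow> int" where
  "contract p e d f = d (f(p := e))"

section \<open>Counting classes through a coarser classification\<close>

text \<open>On \<open>X\<close> the map \<open>\<tau>\<close> factors through
  \<open>\<sigma>\<close>; the factor picks a representative of each \<open>\<sigma>\<close>
  value.\<close>

lemma
  assumes "finite (\<sigma> ` X)" and "\<And>x y. x \<in> X \<Longrightarrow> y \<in> X \<Longrightarrow> \<sigma> x = \<sigma> y \<Longrightarrow> \<tau> x = \<tau> y"
  shows finite_image_coarser: "finite (\<tau> ` X)"
    and card_image_coarser: "card (\<tau> ` X) \<le> card (\<sigma> ` X)"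
proof -
  have "\<tau> ` X \<subseteq> (\<lambda>s. \<tau> (SOME x. x \<in> X \<and> \<sigma> x = s)) ` (\<sigma> ` X)"
  proof
    fix t assume "t \<in> \<tau> ` X"
    then obtain x where x: "x \<in> X" "t = \<tau> x" by auto
    have "\<exists>z. z \<in> X \<and> \<sigma> z = \<sigma> x" using x by auto
    from someI_ex[OF this] have "\<tau> (SOME z. z \<in> X \<and> \<sigma> z = \<sigma> x) = \<tau> x"
      using assms(2) x by blast
    then show "t \<in> (\<lambda>s. \<tau> (SOME x. x \<in> X \<and> \<sigma> x = s)) ` (\<sigma> ` X)" using x by force
  qed
  then show "finite (\<tau> ` X)" "card (\<tau> ` X) \<le> card (\<sigma> ` X)"
    using finite_surj[OF assms(1)] surj_card_le[OF assms(1)] by blast+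
qed

text \<open>Counting \<open>\<sigma>\<close> values fibre by fibre of \<open>\<tau>\<close>, each
  fibre contributes one, and at most \<open>k\<close> more if it contains two different
  \<open>\<sigma>\<close> values.\<close>

lemma card_image_le_fibres:
  assumes fin: "finite (\<sigma> ` X)"
    and coarser: "\<And>x y. x \<in> X \<Longrightarrow> y \<in> X \<Longrightarrow> \<sigma> x = \<sigma> y \<Longrightarrow> \<tau> x = \<tau> y"
    and fib: "\<And>x. x \<in> X \<Longrightarrow> card (\<sigma> ` {y \<in> X. \<tau> y = \<tau> x}) \<le> Suc k"
  shows "card (\<sigma> ` X) \<le>
    card (\<tau> ` X) + k * card (\<tau> ` {x \<in> X. \<exists>y\<in>X. \<tau> y = \<tau> x \<and> \<sigma> y \<noteq> \<sigma> x})"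
proof -
  let ?B = "\<tau> ` {x \<in> X. \<exists>y\<in>X. \<tau> y = \<tau> x \<and> \<sigma> y \<noteq> \<sigma> x}"
  let ?fib = "\<lambda>t. \<sigma> ` {y \<in> X. \<tau> y = t}"
  have finT: "finite (\<tau> ` X)" using fin coarser by (rule finite_image_coarser)
  have BT: "?B \<subseteq> \<tau> ` X" by auto
  have U: "\<sigma> ` X = (\<Union>t\<in>\<tau> ` X. ?fib t)" by auto
  have "card (\<sigma> ` X) \<le> (\<Sum>t\<in>\<tau> ` X. card (?fib t))"
    unfolding U by (rule card_UN_le[OF finT])
  also have "\<dots> \<le> (\<Sum>t\<in>\<tau> ` X. 1 + (if t \<in> ?B then k else 0))"
  proof (rule sum_mono)
    fix t assume "t \<in> \<tau> ` X"
    then obtain x where x: "x \<in> X" "t = \<tau> x" by auto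
    show "card (?fib t) \<le> 1 + (if t \<in> ?B then k else 0)"
    proof (cases "t \<in> ?B")
      case True
      then show ?thesis using fib[OF x(1)] x by simp
    next
      case False
      then have "\<sigma> y = \<sigma> x" if "y \<in> X" "\<tau> y = t" for y
        using that x by blast
      then have "?fib t \<subseteq> {\<sigma> x}" by auto
      then have "card (?fib t) \<le> card {\<sigma> x}" by (intro card_mono) auto
      then show ?thesis using False by simp
    qed
  qed
  also have "\<dots> = card (\<tau> ` X) + (\<Sum>t\<in>\<tau> ` X. if t \<in> ?B then k else 0)"
    by (simp only: sum.distrib) simp
  also have "(\<Sum>t\<in>\<tau> ` X. if t \<in> ?B then k else 0) = (\<Sum>t\<in>?B. k)"
    using BT by (simp only: sum.inter_restrict[OF finT, symmetric] Int_absorb1)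
  finally show ?thesis by (simp add: mult.commute)
qed

section \<open>Functions behaving like a bounded determinant\<close>

text \<open>\<open>exchange\<close> is Cramer's rule without denominators: expand \<open>x\<close>
  in the basis \<open>b\<close> with coefficients \<open>d (b(i := x)) / d b\<close> and insert the
  expansion into entry \<open>k\<close> of \<open>f\<close>. \<open>bound\<close> stands for
  \<Delta>-modularity and \<open>nonzero\<close> for full rank.\<close>

locale pluecker =
  fixes P :: "nat set" and d :: "(nat \<Rightarrow> 'a) \<Rightarrow> int" and D :: nat
  assumes finP: "finite P"
    and anti: "i \<in> P \<Longrightarrow> j \<in> P \<Longrightarrow> i \<noteq> j \<Longrightarrow> d (f(i := f j, j := f i)) = - d f"
    and exchange: "k \<in> P \<Longrightarrow> d b * d (f(k := x)) = (\<Sum>i\<in>P. d (b(i := x)) * d (f(k := b i)))"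
    and bound: "\<bar>d f\<bar> \<le> int D"
    and nonzero: "\<exists>b. d b \<noteq> 0"
begin

lemma repeated: "i \<in> P \<Longrightarrow> j \<in> P \<Longrightarrow> i \<noteq> j \<Longrightarrow> f i = f j \<Longrightarrow> d f = 0"
  using anti[of i j f] by (simp add: fun_upd_idem)

lemma swap: "i \<in> P \<Longrightarrow> j \<in> P \<Longrightarrow> i \<noteq> j \<Longrightarrow> d (f(i := x, j := y)) = - d (f(i := y, j := x))"
  using anti[of i j "f(i := y, j := x)"] by (simp add: fun_upd_twist)

text \<open>By \<open>exchange\<close>, the coordinates of \<open>x\<close> in one fixed basis
  determine \<open>d (f(i := x))\<close> for every tuple \<open>f\<close>.\<close>

lemma sig_eq_iff:
  assumes "d b \<noteq> 0"
  shows "sig P d x = sig P d y \<longleftrightarrow> (\<forall>i\<in>P. d (b(i := x)) = d (b(i := y)))"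
proof
  assume R: "\<forall>i\<in>P. d (b(i := x)) = d (b(i := y))"
  show "sig P d x = sig P d y"
  proof (rule sigI)
    fix i f assume i: "i \<in> P"
    have "d b * d (f(i := x)) = d b * d (f(i := y))"
      unfolding exchange[OF i, of b f x] exchange[OF i, of b f y]
      using R by (intro sum.cong) auto
    then show "d (f(i := x)) = d (f(i := y))" using assms by simp
  qed
qed (auto dest: sigD)

lemma loop:
  assumes "d b \<noteq> 0" and "\<And>i. i \<in> P \<Longrightarrow> d (b(i := x)) = 0" and "i \<in> P"
  shows "d (f(i := x)) = 0"
  using exchange[OF assms(3), of b f x] assms by simp

text \<open>The elements of \<open>X\<close> lie in the span of the \<open>b i\<close> with
  \<open>i \<in> S\<close>, so a signature is determined by \<open>card S\<close> integers between
  \<open>-D\<close> and \<open>D\<close>.\<close>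

lemma card_sig_le:
  assumes b: "d b \<noteq> 0" and S: "S \<subseteq> P"
    and 0: "\<And>x i. x \<in> X \<Longrightarrow> i \<in> P - S \<Longrightarrow> d (b(i := x)) = 0"
  shows "finite (sig P d ` X)" and "card (sig P d ` X) \<le> (2 * D + 1) ^ card S"
proof -
  let ?c = "\<lambda>x. restrict (\<lambda>i. d (b(i := x))) S"
  let ?E = "S \<rightarrow>\<^sub>E {- int D..int D}"
  have fS: "finite S" using S finP finite_subset by blast
  have sub: "?c ` X \<subseteq> ?E" using bound by (force simp: abs_le_iff)
  have fE: "finite ?E" using fS by (simp add: finite_PiE)
  have eq: "sig P d x = sig P d y" if "x \<in> X" "y \<in> X" "?c x = ?c y" for x y
    unfolding sig_eq_iff[OF b]
  proof
    fix i assume i: "i \<in> P"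
    show "d (b(i := x)) = d (b(i := y))"
    proof (cases "i \<in> S")
      case True
      then show ?thesis using fun_cong[OF that(3), of i] by simp
    next
      case False
      then show ?thesis using 0 i that by simp
    qed
  qed
  have fin: "finite (?c ` X)" using sub fE finite_subset by blast
  have "card (sig P d ` X) \<le> card (?c ` X)"
    using fin eq by (rule card_image_coarser)
  also have "\<dots> \<le> card ?E" using fE sub by (rule card_mono)
  also have "\<dots> = (2 * D + 1) ^ card S"
    using fS by (simp add: card_PiE nat_add_distrib nat_mult_distrib)
  finally show "card (sig P d ` X) \<le> (2 * D + 1) ^ card S" .
  show "finite (sig P d ` X)"
    using fin eq by (rule finite_image_coarser)
qed

lemma finite_sig: "finite (sig P d ` X)"
proof -
  obtain b where "d b \<noteq> 0" using nonzero by blast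
  then show ?thesis using card_sig_le(1)[of b P X] by auto
qed

text \<open>In the exchange relation for tuples with \<open>e\<close> at \<open>p\<close>, the
  summand of index \<open>p\<close> puts \<open>e\<close> into entry \<open>k\<close> as well and
  vanishes; the rest is the relation for the contraction.\<close>

lemma pluecker_contract:
  assumes p: "p \<in> P" and nz: "d (g(p := e)) \<noteq> 0"
  shows "pluecker (P - {p}) (contract p e d) D"
proof (unfold_locales, unfold contract_def)
  show "finite (P - {p})" using finP by simp
  show "\<exists>b. d (b(p := e)) \<noteq> 0" using nz by blast
  show "\<bar>d (f(p := e))\<bar> \<le> int D" for f by (rule bound)
  show "d (f(i := f j, j := f i, p := e)) = - d (f(p := e))"
    if "i \<in> P - {p}" "j \<in> P - {p}" "i \<noteq> j" for i j f
  proof -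
    have "f(i := f j, j := f i, p := e) = (f(p := e))(i := (f(p := e)) j, j := (f(p := e)) i)"
      using that by (auto simp: fun_eq_iff)
    then show ?thesis using anti[of i j "f(p := e)"] that by simp
  qed
  show "d (b(p := e)) * d (f(k := x, p := e)) =
      (\<Sum>i\<in>P - {p}. d (b(i := x, p := e)) * d (f(k := b i, p := e)))"
    if k: "k \<in> P - {p}" for k b f x
  proof -
    have tw: "h(i := z, p := e) = (h(p := e))(i := z)" if "i \<noteq> p" for h i z
      using that by (simp add: fun_upd_twist)
    have 0: "d (f(p := e, k := e)) = 0"
      using repeated[of p k "f(p := e, k := e)"] k p by simp
    have "d (b(p := e)) * d ((f(p := e))(k := x)) =
        (\<Sum>i\<in>P. d (b(p := e, i := x)) * d (f(p := e, k := (b(p := e)) i)))"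
      using exchange[of k "b(p := e)" "f(p := e)" x] k by blast
    also have "\<dots> = d (b(p := x)) * d (f(p := e, k := e)) +
        (\<Sum>i\<in>P - {p}. d (b(p := e, i := x)) * d (f(p := e, k := b i)))"
      using p by (subst sum.remove[OF finP p]) (auto intro!: sum.cong)
    finally have "d (b(p := e)) * d ((f(p := e))(k := x)) =
        (\<Sum>i\<in>P - {p}. d (b(p := e, i := x)) * d (f(p := e, k := b i)))" unfolding 0 by simp
    moreover have "\<dots> = (\<Sum>i\<in>P - {p}. d (b(i := x, p := e)) * d (f(k := b i, p := e)))"
      using k by (intro sum.cong refl) (simp add: tw)
    moreover have "f(k := x, p := e) = f(p := e, k := x)" using k by (intro tw) auto
    ultimately show ?thesis by simp
  qed
qed

end

section \<open>The number of classes lost by a contraction\<close>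

context pluecker
begin

text \<open>Elements \<open>x\<close>, \<open>y\<close> merged by the contraction of \<open>e\<close> satisfy \<open>y = x + te\<close> for a scalar \<open>t\<close>;
  this is the form of that statement without division and without vectors.\<close>

lemma partner:
  assumes b: "b p = e" and p: "p \<in> P" and i: "i \<in> P"
    and eq: "sig (P - {p}) (contract p e d) x = sig (P - {p}) (contract p e d) y"
  shows "d b * (d (f(i := y)) - d (f(i := x))) = (d (b(p := y)) - d (b(p := x))) * d (f(i := e))"
proof -
  have same: "d (b(j := x)) = d (b(j := y))" if "j \<in> P - {p}" for j
  proof -
    have "b(j := z) = b(j := z, p := e)" for z using b that by auto
    then show ?thesis using sigD[OF eq that, of b] by (simp add: contract_def)
  qed
  have 0: "(\<Sum>j\<in>P - {p}. (d (b(j := y)) - d (b(j := x))) * d (f(i := b j))) = 0"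
    using same by (intro sum.neutral) simp
  have "d b * (d (f(i := y)) - d (f(i := x))) =
      (\<Sum>j\<in>P. (d (b(j := y)) - d (b(j := x))) * d (f(i := b j)))"
    unfolding right_diff_distrib exchange[OF i, of b f x] exchange[OF i, of b f y]
    by (simp add: sum_subtractf left_diff_distrib)
  also have "\<dots> = (d (b(p := y)) - d (b(p := x))) * d (f(i := e)) +
      (\<Sum>j\<in>P - {p}. (d (b(j := y)) - d (b(j := x))) * d (f(i := b j)))"
    using b by (simp add: sum.remove[OF finP p])
  finally show ?thesis unfolding 0 by simp
qed

text \<open>In a fibre of the contraction \<open>y = x + te\<close>, and the coordinate at
  \<open>p\<close> alone shows whether \<open>t\<close> is zero.\<close>

lemma sig_eq_iff_coord:
  assumes nz: "d b \<noteq> 0" and b: "b p = e" and p: "p \<in> P"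
    and eq: "sig (P - {p}) (contract p e d) x = sig (P - {p}) (contract p e d) y"
  shows "sig P d x = sig P d y \<longleftrightarrow> d (b(p := x)) = d (b(p := y))"
proof
  assume c: "d (b(p := x)) = d (b(p := y))"
  show "sig P d x = sig P d y"
    by (rule sigI) (use partner[of b p e, OF b p _ eq] c nz in auto)
next
  assume "sig P d x = sig P d y"
  then show "d (b(p := x)) = d (b(p := y))" using p by (rule sigD)
qed

lemma sig_imp_sig_contract:
  assumes "p \<in> P" and "sig P d x = sig P d y"
  shows "sig (P - {p}) (contract p e d) x = sig (P - {p}) (contract p e d) y"
proof (rule sigI)
  fix i f assume i: "i \<in> P - {p}"
  then have "f(i := z, p := e) = (f(p := e))(i := z)" for z by (simp add: fun_upd_twist)
  then show "contract p e d (f(i := x)) = contract p e d (f(i := y))" unfolding contract_def using sigD[OF assms(2)] i by simp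
qed

lemma card_fibre:
  assumes nz: "d b \<noteq> 0" and b: "b p = e" and p: "p \<in> P"
    and X: "\<And>x y. x \<in> X \<Longrightarrow> y \<in> X \<Longrightarrow> sig (P - {p}) (contract p e d) x = sig (P - {p}) (contract p e d) y"
    and V: "finite V" "\<And>x. x \<in> X \<Longrightarrow> d (b(p := x)) \<in> V"
  shows "card (sig P d ` X) \<le> card V"
proof -
  have fin: "finite ((\<lambda>x. d (b(p := x))) ` X)" using V by (auto intro: finite_subset)
  have "card (sig P d ` X) \<le> card ((\<lambda>x. d (b(p := x))) ` X)"
    by (rule card_image_coarser[OF fin]) (use sig_eq_iff_coord[of b p e, OF nz b p] X in blast)
  also have "\<dots> \<le> card V" using V by (intro card_mono) auto
  finally show ?thesis .
qed

text \<open>The coordinate at \<open>p\<close> takes at most \<open>2 * D + 1\<close> values, so a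
  fibre loses at most \<open>2 * D\<close> classes, and only fibres that merge distinct classes lose
  any.\<close>

lemma card_sig_le_contract:
  assumes nz: "d b \<noteq> 0" and b: "b p = e" and p: "p \<in> P"
  defines "\<tau> \<equiv> sig (P - {p}) (contract p e d)"
  shows "card (sig P d ` X) \<le> card (\<tau> ` X) +
    2 * D * card (\<tau> ` {x \<in> X. \<exists>y\<in>X. \<tau> y = \<tau> x \<and> sig P d y \<noteq> sig P d x})"
proof (rule card_image_le_fibres[OF finite_sig])
  show "\<tau> x = \<tau> y" if "sig P d x = sig P d y" for x y
    unfolding \<tau>_def using sig_imp_sig_contract[OF p that] .
  show "card (sig P d ` {y \<in> X. \<tau> y = \<tau> x}) \<le> Suc (2 * D)" for x
  proof -
    have "card (sig P d ` {y \<in> X. \<tau> y = \<tau> x}) \<le> card {- int D..int D}"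
      by (rule card_fibre[of b p e, OF nz b p]) (use bound in \<open>auto simp: \<tau>_def abs_le_iff minus_le_iff\<close>)
    then show ?thesis by simp
  qed
qed

text \<open>Each entry changes by a multiple of \<open>e\<close>, so in the multilinear expansion
  every term with two changed entries contains \<open>e\<close> twice and vanishes.\<close>

lemma multi_update:
  assumes b: "d b \<noteq> 0" "b p = e" and p: "p \<in> P" and J: "J \<subseteq> P"
    and eq: "\<And>i. i \<in> J \<Longrightarrow> sig (P - {p}) (contract p e d) (f i) = sig (P - {p}) (contract p e d) (y i)"
  shows "d (override_on f y J) - d f = (\<Sum>i\<in>J. d (f(i := y i)) - d f)"
proof -
  have "finite J" using J finP finite_subset by blast
  then show ?thesis using J eq
  proof (induction J)
    case (insert j J)
    let ?t = "d (b(p := y j)) - d (b(p := f j))"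
    have upd: "d b * (d (g(j := y j)) - d (g(j := f j))) = ?t * d (g(j := e))" for g
      using partner[of b p e, OF b(2) p] insert.prems by simp
    \<comment> \<open>Once entry \<open>j\<close> is \<open>e\<close>, replacing another entry
      within its fibre changes \<open>d\<close> by a multiple of its value on a tuple with two
      entries \<open>e\<close>, hence not at all.\<close>
    have e: "d ((override_on f y J)(j := e)) = d (f(j := e))"
      using insert.hyps(1) subset_refl[of J]
    proof (induction rule: finite_subset_induct)
      case (insert k K)
      have kj: "k \<noteq> j" "k \<in> P" "j \<in> P" using insert.hyps \<open>j \<notin> J\<close> \<open>insert j J \<subseteq> P\<close> by auto
      let ?g = "(override_on f y K)(j := e)"
      have g: "?g(k := f k) = ?g" "?g(k := y k) = (override_on f y (insert k K))(j := e)"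
        using kj insert.hyps by (auto simp: override_on_def)
      have "d (?g(k := e)) = 0" using repeated[of k j "?g(k := e)"] kj by simp
      moreover have "sig (P - {p}) (contract p e d) (f k) = sig (P - {p}) (contract p e d) (y k)"
        using \<open>\<And>i. i \<in> insert j J \<Longrightarrow> _\<close> insert.hyps by blast
      ultimately have "d (?g(k := y k)) = d (?g(k := f k))"
        using partner[of b p e, OF b(2) p kj(2), of "f k" "y k" ?g] b(1) by simp
      then show ?case unfolding g using insert.IH by (rule trans)
    qed (simp add: override_on_def)
    have g: "(override_on f y J)(j := f j) = override_on f y J"
      "(override_on f y J)(j := y j) = override_on f y (insert j J)"
      using insert.hyps by (auto simp: override_on_def)
    have "d b * (d (override_on f y (insert j J)) - d (override_on f y J)) =
        d b * (d (f(j := y j)) - d f)"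
      using upd[of "override_on f y J"] upd[of f] unfolding g e by simp
    then have "d (override_on f y (insert j J)) - d (override_on f y J) = d (f(j := y j)) - d f"
      using b(1) by simp
    moreover have "d (override_on f y J) - d f = (\<Sum>i\<in>J. d (f(i := y i)) - d f)"
      using insert.prems by (intro insert.IH) auto
    ultimately show ?case unfolding sum.insert[OF insert.hyps] by linarith
  qed simp
qed

text \<open>Each replacement of an entry by another member of its fibre changes \<open>d\<close> by a nonzero
  integer that does not depend on the other replacements, so performing all the replacements that
  increase \<open>d\<close> shows that there are few of them.\<close>

lemma card_fibre_positions_le:
  assumes b: "d b \<noteq> 0" "b p = e" and p: "p \<in> P"
  defines "\<tau> \<equiv> sig (P - {p}) (contract p e d)"
  defines "F \<equiv> {x. \<exists>y. \<tau> y = \<tau> x \<and> sig P d y \<noteq> sig P d x}"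
  shows "card {i \<in> P. f i \<in> F \<and> d (f(i := e)) \<noteq> 0} \<le> 4 * D"
proof -
  let ?I = "{i \<in> P. f i \<in> F \<and> d (f(i := e)) \<noteq> 0}"
  have "\<forall>i\<in>?I. \<exists>y. \<tau> y = \<tau> (f i) \<and> sig P d y \<noteq> sig P d (f i)" unfolding F_def by auto
  from bchoice[OF this] obtain y
    where y: "\<And>i. i \<in> ?I \<Longrightarrow> \<tau> (y i) = \<tau> (f i) \<and> sig P d (y i) \<noteq> sig P d (f i)"
    by blast
  let ?\<delta> = "\<lambda>i. d (f(i := y i)) - d f"
  have \<delta>: "?\<delta> i \<noteq> 0" if "i \<in> ?I" for i
  proof -
    have eq: "\<tau> (f i) = \<tau> (y i)" using y[OF that] by simp
    have "d (b(p := y i)) - d (b(p := f i)) \<noteq> 0"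
      using sig_eq_iff_coord[of b p e, OF b p] y[OF that] eq unfolding \<tau>_def by auto
    then show ?thesis using partner[of b p e, OF b(2) p _ eq[unfolded \<tau>_def], of i f] that by auto
  qed
  have half: "card J \<le> 2 * D" if "J \<subseteq> ?I" "\<And>i. i \<in> J \<Longrightarrow> 1 \<le> s * ?\<delta> i" "\<bar>s\<bar> = 1" for J s
  proof -
    have "int (card J) = (\<Sum>i\<in>J. 1)" by simp
    also have "\<dots> \<le> (\<Sum>i\<in>J. s * ?\<delta> i)" using that by (intro sum_mono) auto
    also have "\<dots> = s * (d (override_on f y J) - d f)"
      using that(1) y by (subst multi_update[of b p e, OF b p]) (auto simp: sum_distrib_left \<tau>_def)
    also have "\<dots> \<le> \<bar>d (override_on f y J) - d f\<bar>"
      using that(3) by (auto simp: abs_if split: if_splits)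
    also have "\<dots> \<le> 2 * int D" using bound[of "override_on f y J"] bound[of f] by linarith
    finally show ?thesis by simp
  qed
  let ?I' = "{i \<in> ?I. ?\<delta> i > 0}" and ?I'' = "{i \<in> ?I. ?\<delta> i < 0}"
  have I: "?I = ?I' \<union> ?I''" using \<delta> by force
  have "card ?I \<le> card ?I' + card ?I''" by (subst I) (rule card_Un_le)
  moreover have "card ?I' \<le> 2 * D" by (rule half[where s = 1]) auto
  moreover have "card ?I'' \<le> 2 * D" by (rule half[where s = "-1"]) auto
  ultimately show ?thesis by linarith
qed

end

section \<open>Long circuits and sets without them\<close>

context pluecker
begin

text \<open>\<open>S\<close> is the set of positions of the support of \<open>v\<close> in the basis \<open>b\<close>, so \<open>v\<close> and the \<open>b i\<close> with
  \<open>i \<in> S\<close> form a circuit.\<close>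

definition circuit :: "'a set \<Rightarrow> nat set \<Rightarrow> (nat \<Rightarrow> 'a) \<Rightarrow> 'a \<Rightarrow> bool" where
  "circuit F S b v \<longleftrightarrow> d b \<noteq> 0 \<and> S \<subseteq> P \<and> (\<forall>i\<in>S. b i \<in> F) \<and> v \<in> F \<and>
    (\<forall>i\<in>P. d (b(i := v)) \<noteq> 0 \<longleftrightarrow> i \<in> S)"

text \<open>Some nontrivial line through \<open>v\<close> contains \<open>x\<close> and
  \<open>y\<close> in \<open>F\<close> with \<open>x\<close> outside the span of the circuit. Put
  \<open>x\<close> into the basis at \<open>p\<close>: the support of \<open>v\<close> stays
  \<open>S\<close>, and \<open>y = x + tv\<close> with \<open>t\<close> nonzero has support
  \<open>insert p S\<close>.\<close>

lemma extend_circuit: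
  assumes C: "circuit F S b v" and s: "s \<in> S"
  defines "\<tau> \<equiv> sig (P - {s}) (contract s v d)"
  assumes many: "(2 * D + 1) ^ card S < card (\<tau> ` {x \<in> F. \<exists>y\<in>F. \<tau> y = \<tau> x \<and> sig P d y \<noteq> sig P d x})"
  shows "\<exists>p c w. p \<in> P - S \<and> circuit F (insert p S) c w"
proof -
  let ?X = "{x \<in> F. \<exists>y\<in>F. \<tau> y = \<tau> x \<and> sig P d y \<noteq> sig P d x}"
  have b: "d b \<noteq> 0" and S: "S \<subseteq> P" and bF: "\<And>i. i \<in> S \<Longrightarrow> b i \<in> F" and v: "v \<in> F"
    and vS: "\<And>i. i \<in> P \<Longrightarrow> d (b(i := v)) \<noteq> 0 \<longleftrightarrow> i \<in> S"
    using C unfolding circuit_def by auto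
  have s: "s \<in> P" using S s by blast
  have b1: "d (b(s := v)) \<noteq> 0" using vS s \<open>s \<in> S\<close> by blast
  \<comment> \<open>Otherwise all of \<open>?X\<close> lies in the span of the \<open>b i\<close>
    with \<open>i \<in> S\<close>, which has too few classes for \<open>many\<close>.\<close>
  have "\<exists>x\<in>?X. \<exists>i\<in>P - S. d (b(i := x)) \<noteq> 0"
  proof (rule ccontr)
    assume none: "\<not> ?thesis"
    have "card (sig P d ` ?X) \<le> (2 * D + 1) ^ card S"
    proof (rule card_sig_le(2)[OF b S])
      fix x i assume xi: "x \<in> ?X" "i \<in> P - S"
      show "d (b(i := x)) = 0"
      proof (rule ccontr)
        assume "d (b(i := x)) \<noteq> 0"
        with xi(2) have "\<exists>i\<in>P - S. d (b(i := x)) \<noteq> 0" by (rule bexI[rotated])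
        with xi(1) have "\<exists>x\<in>?X. \<exists>i\<in>P - S. d (b(i := x)) \<noteq> 0" by (rule bexI[rotated])
        with none show False ..
      qed
    qed
    moreover have "card (\<tau> ` ?X) \<le> card (sig P d ` ?X)"
      by (rule card_image_coarser[OF finite_sig]) (unfold \<tau>_def, rule sig_imp_sig_contract[OF s])
    ultimately show False using many by simp
  qed
  then obtain x where X: "x \<in> ?X" and ex: "\<exists>p\<in>P - S. d (b(p := x)) \<noteq> 0" by (rule bexE)
  from ex obtain p where PS: "p \<in> P - S" and px: "d (b(p := x)) \<noteq> 0" by (rule bexE)
  from X obtain y where x: "x \<in> F" and y: "y \<in> F" and eq: "\<tau> x = \<tau> y"
    and neq: "sig P d y \<noteq> sig P d x" by auto
  from PS have p: "p \<in> P" "p \<notin> S" by auto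
  let ?c = "b(p := x)" and ?t = "d (b(s := v, s := y)) - d (b(s := v, s := x))"
  have t: "?t \<noteq> 0"
    using neq sig_eq_iff_coord[of "b(s := v)" s v, OF b1 _ s eq[unfolded \<tau>_def]] by auto
  have part: "d (b(s := v)) * (d (f(i := y)) - d (f(i := x))) = ?t * d (f(i := v))"
    if "i \<in> P" for f i
    using partner[of "b(s := v)" s v, OF _ s that eq[unfolded \<tau>_def]] by simp
  have pv: "d (b(p := v)) = 0" using vS[OF p(1)] p(2) by blast
  have cy: "d (?c(i := y)) \<noteq> 0 \<longleftrightarrow> i \<in> insert p S" if i: "i \<in> P" for i
    proof (cases "i = p")
      case True
      then show ?thesis using part[OF p(1), of b] px pv b1 by auto
    next
      case False
      have "d (?c(i := x)) = 0" using repeated[of p i "?c(i := x)"] p i False by simp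
      then have 1: "d (b(s := v)) * d (?c(i := y)) = ?t * d (?c(i := v))"
        using part[OF i, of ?c] by simp
      have "d b * d (?c(i := v)) = (\<Sum>j\<in>P. d (b(j := v)) * d (?c(i := b j)))"
        by (rule exchange[OF i])
      \<comment> \<open>Only \<open>j = i\<close> survives: \<open>v\<close> has no coordinate at
        \<open>p\<close>, and any other \<open>j\<close> makes \<open>b j\<close> occur
        twice.\<close>
      also have "\<dots> = (\<Sum>j\<in>P. if j = i then d (b(i := v)) * d ?c else 0)"
      proof (rule sum.cong[OF refl])
        fix j assume j: "j \<in> P"
        consider "j = i" | "j = p" | "j \<noteq> i" "j \<noteq> p" by blast
        then show "d (b(j := v)) * d (?c(i := b j)) = (if j = i then d (b(i := v)) * d ?c else 0)"
        proof cases
          case 1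
          have "?c(i := b i) = ?c" using False by auto
          then show ?thesis using 1 by simp
        next
          case 2
          then show ?thesis using pv False by simp
        next
          case 3
          then have "d (?c(i := b j)) = 0" using repeated[of i j "?c(i := b j)"] i j by simp
          then show ?thesis using 3 by simp
        qed
      qed
      also have "\<dots> = d (b(i := v)) * d ?c" using i finP by (simp add: sum.delta)
      finally have "d (?c(i := v)) \<noteq> 0 \<longleftrightarrow> i \<in> S" using vS[OF i] b px by auto
      moreover have "d (?c(i := y)) \<noteq> 0 \<longleftrightarrow> d (?c(i := v)) \<noteq> 0" using 1 t b1 by auto
      ultimately show ?thesis using False by simp
    qed
  have "circuit F (insert p S) ?c y"
    unfolding circuit_def using p px x y bF S cy by auto
  then show ?thesis using PS by blast
qed

text \<open>A set all of whose circuits are short has linearly many classes: otherwise, after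
  contractions, every element lies on many long lines, and a path of triangles
  \<open>{f\<^sub>i, g\<^sub>i, f\<^sub>i\<^sub>+\<^sub>1}\<close> in general position yields the long circuit
  \<open>{f\<^sub>0, g\<^sub>0, \<dots>, g\<^sub>k, f\<^sub>k\<^sub>+\<^sub>1}\<close>.\<close>

lemma ex_few_long_lines:
  assumes short: "\<And>b v. d b \<noteq> 0 \<Longrightarrow> v \<in> F \<Longrightarrow> card {i \<in> P. b i \<in> F \<and> d (b(i := v)) \<noteq> 0} \<le> K"
    and nonloop: "e0 \<in> F" "i0 \<in> P" "d (f0(i0 := e0)) \<noteq> 0"
  obtains b p where "d b \<noteq> 0" "p \<in> P" "b p \<in> F"
    "card (sig (P - {p}) (contract p (b p) d) ` {x \<in> F. \<exists>y\<in>F.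
        sig (P - {p}) (contract p (b p) d) y = sig (P - {p}) (contract p (b p) d) x \<and>
        sig P d y \<noteq> sig P d x}) \<le> (2 * D + 1) ^ K"
proof (rule ccontr)
  let ?nontriv = "\<lambda>p e. sig (P - {p}) (contract p e d) ` {x \<in> F. \<exists>y\<in>F.
        sig (P - {p}) (contract p e d) y = sig (P - {p}) (contract p e d) x \<and>
        sig P d y \<noteq> sig P d x}"
  assume "\<not> thesis"
  with that have many: "(2 * D + 1) ^ K < card (?nontriv p (b p))"
    if "d b \<noteq> 0" "p \<in> P" "b p \<in> F" for b p using that by (meson not_less)
  have "\<exists>S b v. card S = Suc k \<and> circuit F S b v" if "k \<le> K" for k
    using that
  proof (induction k)
    case 0
    \<comment> \<open>The construction starts from a degenerate circuit, with \<open>e0\<close> both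
      as basis element and as \<open>v\<close>.\<close>
    define b where "b = f0(i0 := e0)"
    have b: "d b \<noteq> 0" "b i0 = e0" using nonloop by (auto simp: b_def)
    have "d (b(i := e0)) \<noteq> 0 \<longleftrightarrow> i \<in> {i0}" if "i \<in> P" for i
    proof (cases "i = i0")
      case False
      then show ?thesis using repeated[of i i0 "b(i := e0)"] that nonloop b by simp
    next
      case True
      then have "b(i := e0) = b" using b by auto
      then show ?thesis using True b by simp
    qed
    then have "circuit F {i0} b e0" unfolding circuit_def using nonloop b by simp
    then show ?case by force
  next
    case (Suc k)
    then obtain S b v where S: "card S = Suc k" and C: "circuit F S b v" by (meson Suc_leD)
    obtain s where s: "s \<in> S" using S by fastforce
    have "(2 * D + 1) ^ card S \<le> (2 * D + 1) ^ K"
      using S Suc.prems by (intro power_increasing) auto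
    also have "\<dots> < card (?nontriv s v)"
      using many[of "b(s := v)" s] s C unfolding circuit_def by auto
    finally obtain p c w where p: "p \<in> P - S" and c: "circuit F (insert p S) c w"
      using extend_circuit[OF C s] by blast
    have "finite S" using C finP finite_subset unfolding circuit_def by blast
    then have "card (insert p S) = Suc (Suc k)" using S p by simp
    then show ?case using c by blast
  qed
  from this[of K] obtain S b v where *: "card S = Suc K" "d b \<noteq> 0" "S \<subseteq> P" "\<forall>i\<in>S. b i \<in> F"
    "v \<in> F" "\<forall>i\<in>P. d (b(i := v)) \<noteq> 0 \<longleftrightarrow> i \<in> S" unfolding circuit_def by blast
  then have "S \<subseteq> {i \<in> P. b i \<in> F \<and> d (b(i := v)) \<noteq> 0}" by blast
  then have "card S \<le> card {i \<in> P. b i \<in> F \<and> d (b(i := v)) \<noteq> 0}"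
    using finP by (intro card_mono) auto
  then show False using short[of b v] * by simp
qed

end

text \<open>Contract an element with few long lines, losing at most
  \<open>2 * D * (2 * D + 1) ^ K\<close> classes, and repeat; adjoining the contracted element to a
  basis of the contraction shows that circuits stay short. The \<open>+ 1\<close> is the zero
  signature, which remains when all of \<open>F\<close> consists of loops.\<close>

lemma card_sig_short_circuits_le:
  assumes "pluecker P d D"
    and "\<And>b v. d b \<noteq> 0 \<Longrightarrow> v \<in> F \<Longrightarrow> card {i \<in> P. b i \<in> F \<and> d (b(i := v)) \<noteq> 0} \<le> K"
  shows "card (sig P d ` F) \<le> 2 * D * (2 * D + 1) ^ K * card P + 1"
  using assms
proof (induction "card P" arbitrary: P d)
  case 0
  then have "P = {}" by (simp add: pluecker.finP)
  then have "sig P d ` F \<subseteq> {\<lambda>_. 0}" by (auto simp: sig_def)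
  then have "card (sig P d ` F) \<le> card {\<lambda>_ :: nat \<times> (nat \<Rightarrow> 'a). 0 :: int}"
    by (intro card_mono) auto
  then show ?case by simp
next
  case (Suc m)
  interpret pluecker P d D by fact
  show ?case
  proof (cases "\<exists>e\<in>F. \<exists>i\<in>P. \<exists>f. d (f(i := e)) \<noteq> 0")
    case False
    then have "sig P d ` F \<subseteq> {\<lambda>_. 0}" by (auto simp: sig_def)
    then have "card (sig P d ` F) \<le> card {\<lambda>_ :: nat \<times> (nat \<Rightarrow> 'a). 0 :: int}"
      by (intro card_mono) auto
    then show ?thesis by simp
  next
    case True
    then obtain e0 i0 f0 where nonloop: "e0 \<in> F" "i0 \<in> P" "d (f0(i0 := e0)) \<noteq> 0" by blast
    obtain b p where b: "d b \<noteq> 0" and p: "p \<in> P" and "b p \<in> F" and few: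
      "card (sig (P - {p}) (contract p (b p) d) ` {x \<in> F. \<exists>y\<in>F.
          sig (P - {p}) (contract p (b p) d) y = sig (P - {p}) (contract p (b p) d) x \<and>
          sig P d y \<noteq> sig P d x}) \<le> (2 * D + 1) ^ K"
      by (rule ex_few_long_lines[of F K e0 i0 f0, OF Suc.prems(2) nonloop])
    let ?e = "b p"
    have "card (sig (P - {p}) (contract p ?e d) ` F)
        \<le> 2 * D * (2 * D + 1) ^ K * card (P - {p}) + 1"
    proof (rule Suc.hyps)
      show "m = card (P - {p})" using Suc.hyps(2) p finP by simp
      show "pluecker (P - {p}) (contract p ?e d) D"
        using pluecker_contract[of p b ?e] p b by simp
      fix c v assume c: "contract p ?e d c \<noteq> 0" and v: "v \<in> F"
      have "{i \<in> P - {p}. c i \<in> F \<and> contract p ?e d (c(i := v)) \<noteq> 0} \<subseteq>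
          {i \<in> P. (c(p := ?e)) i \<in> F \<and> d ((c(p := ?e))(i := v)) \<noteq> 0}"
        by (auto simp: contract_def fun_upd_twist)
      then have "card {i \<in> P - {p}. c i \<in> F \<and> contract p ?e d (c(i := v)) \<noteq> 0} \<le>
          card {i \<in> P. (c(p := ?e)) i \<in> F \<and> d ((c(p := ?e))(i := v)) \<noteq> 0}"
        using finP by (intro card_mono) auto
      also have "\<dots> \<le> K" using c v unfolding contract_def by (rule Suc.prems(2))
      finally show "card {i \<in> P - {p}. c i \<in> F \<and> contract p ?e d (c(i := v)) \<noteq> 0} \<le> K" .
    qed
    moreover have "2 * D * card (sig (P - {p}) (contract p ?e d) ` {x \<in> F. \<exists>y\<in>F.
          sig (P - {p}) (contract p ?e d) y = sig (P - {p}) (contract p ?e d) x \<and>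
          sig P d y \<noteq> sig P d x}) \<le> 2 * D * (2 * D + 1) ^ K"
      using few by (intro mult_left_mono) auto
    moreover
    have "card P = Suc (card (P - {p}))" using p finP by (metis card_Suc_Diff1)
    then have "2 * D * (2 * D + 1) ^ K * card P =
        2 * D * (2 * D + 1) ^ K * card (P - {p}) + 2 * D * (2 * D + 1) ^ K"
      by simp
    ultimately show ?thesis using card_sig_le_contract[OF b refl p, of F] by linarith
  qed
qed

section \<open>The cost of contracting one element\<close>

text \<open>Up to \<open>2 * D\<close> classes are lost per nontrivial fibre; the second factor
  comes from the bound for short circuits with \<open>K = 4 * D\<close>, its inner
  \<open>+ 1\<close> absorbing the additive constant once \<open>card P\<close> is positive.\<close>

definition loss :: "nat \<Rightarrow> nat" where
  "loss D = 2 * D * (2 * D * (2 * D + 1) ^ (4 * D) + 1)"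

lemma (in pluecker) card_sig_contract_loss:
  assumes b: "d b \<noteq> 0" and p: "p \<in> P"
  shows "card (range (sig P d)) \<le>
    card (range (sig (P - {p}) (contract p (b p) d))) + loss D * card P"
proof -
  let ?\<tau> = "sig (P - {p}) (contract p (b p) d)"
  let ?F = "{x. \<exists>y. ?\<tau> y = ?\<tau> x \<and> sig P d y \<noteq> sig P d x}"
  have "card (?\<tau> ` ?F) \<le> 2 * D * (2 * D + 1) ^ (4 * D) * card (P - {p}) + 1"
  proof (rule card_sig_short_circuits_le)
    show "pluecker (P - {p}) (contract p (b p) d) D"
      using pluecker_contract[of p b "b p"] p b by simp
    fix c v assume v: "v \<in> ?F"
    \<comment> \<open>Alternation interchanges \<open>v\<close> and the contracted element: where
      \<open>v\<close> can enter beside \<open>b p\<close>, there \<open>b p\<close> can enter a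
      tuple with \<open>v\<close> at \<open>p\<close>, which happens at no more than
      \<open>4 * D\<close> positions holding elements of \<open>?F\<close>.\<close>
    have "{i \<in> P - {p}. c i \<in> ?F \<and> contract p (b p) d (c(i := v)) \<noteq> 0} \<subseteq>
      {i \<in> P. (c(p := v)) i \<in> ?F \<and> d ((c(p := v))(i := b p)) \<noteq> 0}"
    proof
      fix i assume i: "i \<in> {i \<in> P - {p}. c i \<in> ?F \<and> contract p (b p) d (c(i := v)) \<noteq> 0}"
      then have "d (c(p := v, i := b p)) = - d (c(p := b p, i := v))" using p by (intro swap) auto
      moreover have "c(p := b p, i := v) = c(i := v, p := b p)" using i by (intro fun_upd_twist) auto
      ultimately show "i \<in> {i \<in> P. (c(p := v)) i \<in> ?F \<and> d ((c(p := v))(i := b p)) \<noteq> 0}"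
        using i by (simp add: contract_def)
    qed
    then have "card {i \<in> P - {p}. c i \<in> ?F \<and> contract p (b p) d (c(i := v)) \<noteq> 0} \<le>
      card {i \<in> P. (c(p := v)) i \<in> ?F \<and> d ((c(p := v))(i := b p)) \<noteq> 0}"
      using finP by (intro card_mono) auto
    also have "\<dots> \<le> 4 * D" by (rule card_fibre_positions_le[OF b refl p])
    finally show "card {i \<in> P - {p}. c i \<in> ?F \<and> contract p (b p) d (c(i := v)) \<noteq> 0} \<le> 4 * D" .
  qed
  also have "\<dots> \<le> 2 * D * (2 * D + 1) ^ (4 * D) * card P + card P"
  proof (rule add_mono)
    show "1 \<le> card P" using p finP by (metis One_nat_def Suc_leI card_gt_0_iff empty_iff)
  qed (intro mult_left_mono card_mono, use finP in auto)
  finally have "2 * D * card (?\<tau> ` ?F) \<le>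
      2 * D * (2 * D * (2 * D + 1) ^ (4 * D) * card P + card P)"
    by (intro mult_left_mono) auto
  also have "\<dots> = loss D * card P" unfolding loss_def by (simp add: algebra_simps)
  finally have "2 * D * card (?\<tau> ` ?F) \<le> loss D * card P" .
  then show ?thesis using card_sig_le_contract[OF b refl p, of UNIV] by simp
qed

section \<open>Unimodular and non-unimodular small circuits\<close>

lemma (in pluecker) sig_contractD:
  assumes "sig (P - {p}) (contract p e d) x = sig (P - {p}) (contract p e d) y"
    and "h p = e" "k \<in> P - {p}"
  shows "d (h(k := x)) = d (h(k := y))"
proof -
  have "h(k := z, p := e) = h(k := z)" for z using assms(2,3) by auto
  then show ?thesis using sigD[OF assms(1,3), of h] by (simp add: contract_def)
qed

lemma (in pluecker) sig_contract_eq_iff: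
  assumes "d b \<noteq> 0" "b p = e" "p \<in> P"
  shows "sig (P - {p}) (contract p e d) x = sig (P - {p}) (contract p e d) y \<longleftrightarrow>
    (\<forall>i\<in>P - {p}. d (b(i := x)) = d (b(i := y)))"
proof -
  have b: "b(p := e) = b" using assms(2) by auto
  interpret C: pluecker "P - {p}" "contract p e d" D
    using pluecker_contract[of p b e] assms(1,3) b by simp
  have "b(i := z, p := e) = b(i := z)" if "i \<in> P - {p}" for i z using that assms(2) by auto
  then show ?thesis using C.sig_eq_iff[of b x y] assms(1) b by (simp add: contract_def)
qed

text \<open>The quotient \<open>d (b(p := x)) / d b\<close> is the coefficient of \<open>b p\<close>
  in \<open>x\<close>. Thus an element spanned by at most \<open>r\<close> members of a basis has
  all its coefficients in \<open>{0, 1, -1}\<close>.\<close>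

definition (in pluecker) unimodular :: "nat \<Rightarrow> bool" where
  "unimodular r \<longleftrightarrow> (\<forall>b x S p. d b \<noteq> 0 \<longrightarrow> S \<subseteq> P \<longrightarrow> card S \<le> r \<longrightarrow> p \<in> S \<longrightarrow>
     (\<forall>i\<in>P - S. d (b(i := x)) = 0) \<longrightarrow> d (b(p := x)) \<in> {0, d b, - d b})"

lemma (in pluecker) unimodularD:
  assumes "unimodular r" "d b \<noteq> 0" "S \<subseteq> P" "card S \<le> r" "p \<in> S"
    "\<And>i. i \<in> P - S \<Longrightarrow> d (b(i := x)) = 0"
  shows "d (b(p := x)) \<in> {0, d b, - d b}"
  using assms unfolding unimodular_def by metis

text \<open>Contracting the entries of \<open>g\<close> on \<open>S\<close> one by one leaves only
  the values \<open>d (override_on h g S)\<close>, which lie strictly below \<open>D\<close> in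
  absolute value.\<close>

lemma contract_set_loss:
  fixes d :: "(nat \<Rightarrow> 'a) \<Rightarrow> int"
  assumes "finite S" "pluecker P d D" "S \<subseteq> P" "d g \<noteq> 0"
    "\<And>h. \<bar>d (override_on h g S)\<bar> < int D"
  shows "\<exists>P' d' :: (nat \<Rightarrow> 'a) \<Rightarrow> int. pluecker P' d' (D - 1) \<and> card P' \<le> card P \<and>
    card (range (sig P d)) \<le> card (range (sig P' d')) + card S * (loss D * card P)"
  using assms
proof (induction S arbitrary: P d)
  case empty
  interpret pluecker P d D by fact
  have "\<bar>d h\<bar> \<le> int (D - 1)" for h using empty.prems(4)[of h] by simp
  then have "pluecker P d (D - 1)"
    using finP anti exchange nonzero by unfold_locales
  then have "pluecker P d (D - 1) \<and> card P \<le> card P \<and>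
      card (range (sig P d)) \<le> card (range (sig P d)) + card ({} :: nat set) * (loss D * card P)"
    by simp
  then show ?case by (intro exI)
next
  case (insert p S)
  interpret pluecker P d D by fact
  have p: "p \<in> P" using insert.prems by simp
  have "\<exists>P' d' :: (nat \<Rightarrow> 'a) \<Rightarrow> int. pluecker P' d' (D - 1) \<and> card P' \<le> card (P - {p}) \<and>
    card (range (sig (P - {p}) (contract p (g p) d))) \<le>
      card (range (sig P' d')) + card S * (loss D * card (P - {p}))"
  proof (rule insert.IH)
    show "pluecker (P - {p}) (contract p (g p) d) D"
      using pluecker_contract[of p g "g p"] p insert.prems by simp
    show "S \<subseteq> P - {p}" using insert.prems insert.hyps by auto
    show "contract p (g p) d g \<noteq> 0" using insert.prems by (simp add: contract_def)
    fix h
    have "(override_on h g S)(p := g p) = override_on h g (insert p S)"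
      by (auto simp: override_on_def)
    then show "\<bar>contract p (g p) d (override_on h g S)\<bar> < int D"
      using insert.prems(4)[of h] by (simp add: contract_def)
  qed
  then obtain P' and d' :: "(nat \<Rightarrow> 'a) \<Rightarrow> int" where P': "pluecker P' d' (D - 1)" "card P' \<le> card (P - {p})"
    "card (range (sig (P - {p}) (contract p (g p) d))) \<le>
      card (range (sig P' d')) + card S * (loss D * card (P - {p}))" by blast
  have le: "card (P - {p}) \<le> card P" using finP by (intro card_mono) auto
  then have "card S * (loss D * card (P - {p})) \<le> card S * (loss D * card P)"
    by (intro mult_left_mono) auto
  moreover have "card (insert p S) * (loss D * card P) = loss D * card P + card S * (loss D * card P)"
    using insert.hyps by simp
  ultimately have "card (range (sig P d)) \<le>
      card (range (sig P' d')) + card (insert p S) * (loss D * card P)"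
    using card_sig_contract_loss[of g p] p P'(3) insert.prems(3) by linarith
  then show ?case using P' le by (meson order_trans)
qed

lemma abs_less_if_scaled:
  fixes x y u w :: int
  assumes "x * w = y * u" "\<bar>y\<bar> < \<bar>x\<bar>" "\<bar>u\<bar> \<le> n" "0 < n"
  shows "\<bar>w\<bar> < n"
proof (rule ccontr)
  assume "\<not> \<bar>w\<bar> < n"
  then have "\<bar>x\<bar> * n \<le> \<bar>x\<bar> * \<bar>w\<bar>" by (intro mult_left_mono) auto
  also have "\<dots> = \<bar>y\<bar> * \<bar>u\<bar>" using assms(1) by (metis abs_mult)
  also have "\<dots> \<le> \<bar>y\<bar> * n" using assms(3) by (intro mult_left_mono) auto
  also have "\<dots> < \<bar>x\<bar> * n" using assms(2,4) by (intro mult_strict_right_mono)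
  finally show False by simp
qed

text \<open>If two bases of a small flat have different \<open>\<bar>d\<bar>\<close>, the ratio is the same for all their
  extensions, so contracting the smaller one strictly decreases the bound.\<close>

lemma (in pluecker) not_unimodular_contract:
  assumes "\<not> unimodular r"
  shows "\<exists>P' d' :: (nat \<Rightarrow> 'a) \<Rightarrow> int. pluecker P' d' (D - 1) \<and> card P' \<le> card P \<and>
    card (range (sig P d)) \<le> card (range (sig P' d')) + r * (loss D * card P)"
proof -
  obtain b x S p where b: "d b \<noteq> 0" and S: "S \<subseteq> P" "card S \<le> r" and p: "p \<in> S"
    and supp: "\<forall>i\<in>P - S. d (b(i := x)) = 0" and bad: "d (b(p := x)) \<notin> {0, d b, - d b}"
    using assms unfolding unimodular_def by blast
  have fS: "finite S" using S(1) finP by (rule finite_subset)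
  have D: "0 < int D" using b bound[of b] by linarith
  let ?c = "b(p := x)"
  \<comment> \<open>In the exchange relation at \<open>p\<close>, indices
    \<open>j \<noteq> p\<close> in \<open>S\<close> give a repeated entry and indices outside
    \<open>S\<close> a zero coordinate of \<open>x\<close>, so one term is left.\<close>
  have scale: "d b * d (override_on h ?c S) = d ?c * d (override_on h b S)" for h
  proof -
    let ?h = "override_on h b S"
    have 1: "override_on h ?c S = ?h(p := x)" "?h(p := b p) = ?h"
      using p by (auto simp: override_on_def)
    have "d b * d (?h(p := x)) = (\<Sum>j\<in>P. d (b(j := x)) * d (?h(p := b j)))"
      using p S by (intro exchange) auto
    also have "\<dots> = (\<Sum>j\<in>P. if j = p then d ?c * d ?h else 0)"
    proof (rule sum.cong[OF refl])
      fix j assume j: "j \<in> P"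
      consider "j = p" | "j \<noteq> p" "j \<in> S" | "j \<notin> S" using p by blast
      then show "d (b(j := x)) * d (?h(p := b j)) = (if j = p then d ?c * d ?h else 0)"
      proof cases
        case 2
        then have "d (?h(p := b j)) = 0"
          using repeated[of p j "?h(p := b j)"] j p S by (auto simp: override_on_def)
        then show ?thesis using 2 by simp
      next
        case 3
        then have "d (b(j := x)) = 0" using supp j by blast
        then show ?thesis using 3 p by auto
      qed (use 1 in simp)
    qed
    also have "\<dots> = d ?c * d ?h" using p S finP by (auto simp: sum.delta)
    finally show ?thesis unfolding 1 .
  qed
  \<comment> \<open>The witness is whichever of \<open>b\<close> and \<open>?c\<close> has the
    smaller absolute value of \<open>d\<close>; \<open>bad\<close> makes these values differ and
    \<open>d ?c\<close> nonzero.\<close>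
  have ex: "\<exists>g. d g \<noteq> 0 \<and> (\<forall>h. \<bar>d (override_on h g S)\<bar> < int D)"
  proof (cases "\<bar>d ?c\<bar> < \<bar>d b\<bar>")
    case True
    have "\<bar>d (override_on h ?c S)\<bar> < int D" for h
      by (rule abs_less_if_scaled[OF scale True bound D])
    moreover have "d ?c \<noteq> 0" using bad by simp
    ultimately show ?thesis by blast
  next
    case False
    then have less: "\<bar>d b\<bar> < \<bar>d ?c\<bar>" using bad by (auto simp: abs_if split: if_splits)
    have "\<bar>d (override_on h b S)\<bar> < int D" for h
      by (rule abs_less_if_scaled[OF scale[symmetric] less bound D])
    then show ?thesis using b by blast
  qed
  have "card S * (loss D * card P) \<le> r * (loss D * card P)" using S by (intro mult_right_mono) auto
  then show ?thesis
    using ex contract_set_loss[OF fS pluecker_axioms S(1)] by (meson add_left_mono order_trans)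
qed

text \<open>For a circuit with at least three elements, each replaceable within its fibre, \<open>d\<close> takes
  values that differ by at least \<open>3 \<bar>d c\<bar>\<close>, which unimodularity forbids.\<close>

lemma (in pluecker) unimodular_no_long_fibre_circuit:
  assumes U: "unimodular r" and c: "d c \<noteq> 0" "c p = e" and S: "S \<subseteq> P" "card S \<le> r"
    and pij: "p \<in> S" "i \<in> S" "j \<in> S" "i \<noteq> p" "j \<noteq> p" "i \<noteq> j"
    and supp: "\<And>k. k \<in> P - S \<Longrightarrow> d (c(k := v)) = 0"
    and nz: "d (c(i := v)) \<noteq> 0" "d (c(j := v)) \<noteq> 0"
  defines "\<tau> \<equiv> sig (P - {p}) (contract p e d)"
  defines "F \<equiv> {x. \<exists>y. \<tau> y = \<tau> x \<and> sig P d y \<noteq> sig P d x}"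
  assumes F: "v \<in> F" "c i \<in> F" "c j \<in> F"
  shows False
proof -
  have P: "p \<in> P" "i \<in> P" "j \<in> P" using pij S by auto
  let ?T = "{p, i, j}" and ?l = "c(p := v)" and ?q = "d c"
  have "?l k \<in> F" if "k \<in> ?T" for k using F that pij by auto
  then have "\<forall>k\<in>?T. \<exists>y. \<tau> y = \<tau> (?l k) \<and> sig P d y \<noteq> sig P d (?l k)" unfolding F_def by blast
  from bchoice[OF this] obtain y
    where y: "\<And>k. k \<in> ?T \<Longrightarrow> \<tau> (y k) = \<tau> (?l k)"
      "\<And>k. k \<in> ?T \<Longrightarrow> sig P d (y k) \<noteq> sig P d (?l k)" by blast
  have same: "d (h(k := x)) = d (h(k := z))" if "\<tau> x = \<tau> z" "h p = e" "k \<in> P - {p}" for x z h k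
    using sig_contractD[of p e x z h k, OF that(1)[unfolded \<tau>_def] that(2,3)] .
  \<comment> \<open>Replacements within fibres are invisible modulo \<open>e\<close>, so those at
    \<open>i\<close> and \<open>j\<close> turn \<open>c\<close> into a basis with the same
    \<open>d\<close>, and the element put at \<open>p\<close> still has support in \<open>S\<close>;
    unimodularity applies to it.\<close>
  have val: "d (override_on ?l y J) \<in> {0, ?q, - ?q}" if J: "J \<subseteq> ?T" for J
  proof -
    define a b w where "a = (if i \<in> J then y i else c i)" and "b = (if j \<in> J then y j else c j)"
      and "w = (if p \<in> J then y p else v)"
    have \<tau>: "\<tau> a = \<tau> (c i)" "\<tau> b = \<tau> (c j)" "\<tau> w = \<tau> v"
      using y(1)[of i] y(1)[of j] y(1)[of p] pij by (auto simp: a_def b_def w_def)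
    let ?c = "c(i := a, j := b)"
    have upd: "d (h(i := a, j := b)) = d h" if h: "h p = e" "h i = c i" "h j = c j" for h
    proof -
      have "d (h(i := a, j := b)) = d (h(i := a, j := c j))"
        using same[OF \<tau>(2), of "h(i := a)" j] h pij P by simp
      also have "h(i := a, j := c j) = h(i := a)" using h pij by auto
      also have "d \<dots> = d (h(i := c i))" using same[OF \<tau>(1), of h i] h pij P by simp
      also have "h(i := c i) = h" using h by auto
      finally show ?thesis .
    qed
    have "override_on ?l y J = ?c(p := w)"
      using J pij by (auto simp: override_on_def a_def b_def w_def fun_eq_iff)
    moreover have dc: "d ?c = ?q" using upd[of c] c(2) by simp
    moreover have "d (?c(p := w)) \<in> {0, d ?c, - d ?c}"
    proof (rule unimodularD[OF U _ S pij(1)])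
      show "d ?c \<noteq> 0" using dc c by simp
      fix k assume k: "k \<in> P - S"
      then have k': "k \<noteq> i" "k \<noteq> j" "k \<noteq> p" "k \<in> P - {p}" using pij by auto
      have "d (?c(k := w)) = d (?c(k := v))" using same[OF \<tau>(3), of ?c k] k' c(2) pij by simp
      moreover have "?c(k := v) = (c(k := v))(i := a, j := b)" using k' by auto
      moreover have "d ((c(k := v))(i := a, j := b)) = d (c(k := v))"
        using upd[of "c(k := v)"] k' c(2) by simp
      ultimately show "d (?c(k := w)) = 0" using supp[OF k] by (simp only:)
    qed
    ultimately show ?thesis by simp
  qed
  let ?\<delta> = "\<lambda>k. d (?l(k := y k)) - d ?l"
  \<comment> \<open>The change is a nonzero difference of two members of
    \<open>{0, ?q, - ?q}\<close>.\<close>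
  have \<delta>: "\<bar>?q\<bar> \<le> \<bar>?\<delta> k\<bar>" if k: "k \<in> ?T" for k
  proof -
    have kP: "k \<in> P" using k P by auto
    have eq: "\<tau> (?l k) = \<tau> (y k)" using y(1)[OF k] by simp
    let ?t = "d (c(p := y k)) - d (c(p := ?l k))"
    have t: "?t \<noteq> 0"
      using sig_eq_iff_coord[of c p e, OF c P(1) eq[unfolded \<tau>_def]] y(2)[OF k] by auto
    have part: "?q * ?\<delta> k = ?t * d (?l(k := e))"
      using partner[of c p e, OF c(2) P(1) kP eq[unfolded \<tau>_def], of ?l] by (simp only: fun_upd_triv)
    have sw: "d (c(p := v, m := e)) = - d (c(m := v))" if m: "m \<in> P" "m \<noteq> p" for m
    proof -
      have "c(p := e, m := v) = c(m := v)" using c(2) by auto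
      then show ?thesis using swap[of p m c v e] m P by simp
    qed
    have "c(p := v, p := e) = c" using c(2) by auto
    then have "d (?l(k := e)) \<noteq> 0"
      using k sw[OF P(2)] sw[OF P(3)] pij nz c(1) by auto
    then have "?\<delta> k \<noteq> 0" using part t by auto
    moreover have "?l(k := y k) = override_on ?l y {k}" "?l = override_on ?l y {}"
      by (auto simp: override_on_def)
    then have "d (?l(k := y k)) \<in> {0, ?q, - ?q}" "d ?l \<in> {0, ?q, - ?q}"
      using val[of "{k}"] val[of "{}"] k by auto
    ultimately show ?thesis by auto
  qed
  have sum: "d (override_on ?l y J) - d ?l = sum ?\<delta> J" if "J \<subseteq> ?T" for J
    using that P y(1) by (intro multi_update[of c p e, OF c P(1)]) (auto simp: \<tau>_def)
  \<comment> \<open>Performing exactly the increasing replacements, or exactly the decreasing ones,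
    gives two values whose difference is the sum of all three absolute changes.\<close>
  let ?A = "{k \<in> ?T. 0 \<le> ?\<delta> k}" and ?B = "{k \<in> ?T. ?\<delta> k < 0}"
  have diff: "u - w \<le> 2 * \<bar>?q\<bar>" if "u \<in> {0, ?q, - ?q}" "w \<in> {0, ?q, - ?q}" for u w
    using that by auto
  have AB: "d (override_on ?l y ?A) - d ?l = sum ?\<delta> ?A" "d (override_on ?l y ?B) - d ?l = sum ?\<delta> ?B"
    by (rule sum; blast)+
  have "3 * \<bar>?q\<bar> = (\<Sum>k\<in>?T. \<bar>?q\<bar>)" using pij by simp
  also have "\<dots> \<le> (\<Sum>k\<in>?T. \<bar>?\<delta> k\<bar>)" using \<delta> by (rule sum_mono)
  also have "\<dots> = (\<Sum>k\<in>?A. \<bar>?\<delta> k\<bar>) + (\<Sum>k\<in>?B. \<bar>?\<delta> k\<bar>)"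
    by (subst sum.union_disjoint[symmetric]) (auto intro!: sum.cong)
  also have "\<dots> = sum ?\<delta> ?A - sum ?\<delta> ?B"
    by (simp add: sum_negf[symmetric])
  also have "\<dots> = d (override_on ?l y ?A) - d (override_on ?l y ?B)"
    unfolding AB[symmetric] by simp
  also have "\<dots> \<le> 2 * \<bar>?q\<bar>" by (rule diff; rule val; blast)
  finally show False using c(1) by simp
qed

section \<open>Contraction when small circuits are unimodular\<close>

text \<open>Take a basis through \<open>e\<close> with as many members in \<open>G\<close> as
  possible. By maximality each \<open>v\<close> in \<open>G\<close> is supported, modulo
  \<open>e\<close>, on members of \<open>G\<close>; the support has at most \<open>4 * D\<close>
  elements, so two of them would give a forbidden fibre circuit. Hence \<open>v\<close> is, modulo
  \<open>e\<close>, plus or minus one basis element.\<close>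

lemma (in pluecker) card_unimodular_fibres_le:
  assumes U: "unimodular r" and r: "4 * D + 1 \<le> r" and b: "d b \<noteq> 0" "b p = e" and p: "p \<in> P"
  defines "\<tau> \<equiv> sig (P - {p}) (contract p e d)"
  defines "F \<equiv> {x. \<exists>y. \<tau> y = \<tau> x \<and> sig P d y \<noteq> sig P d x}"
  assumes G: "G \<subseteq> F" and nonloop: "\<And>v. v \<in> G \<Longrightarrow> \<exists>i\<in>P - {p}. d (b(i := v)) \<noteq> 0"
  shows "card (\<tau> ` G) \<le> 2 * card (P - {p})"
proof -
  let ?T = "\<lambda>c :: nat \<Rightarrow> 'a. {i \<in> P - {p}. c i \<in> G}"
  have "\<exists>c. (d c \<noteq> 0 \<and> c p = e) \<and> (\<forall>c'. d c' \<noteq> 0 \<and> c' p = e \<longrightarrow> card (?T c') \<le> card (?T c))"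
  proof (rule ex_has_greatest_nat[where k = b and b = "Suc (card P)"])
    show "\<forall>c. d c \<noteq> 0 \<and> c p = e \<longrightarrow> card (?T c) < Suc (card P)"
      using finP by (auto intro!: card_mono simp: less_Suc_eq_le)
  qed (use b in auto)
  then obtain c where c: "d c \<noteq> 0" "c p = e"
    and max: "\<And>c'. d c' \<noteq> 0 \<Longrightarrow> c' p = e \<Longrightarrow> card (?T c') \<le> card (?T c)" by blast
  let ?I = "\<lambda>v. {i \<in> P - {p}. d (c(i := v)) \<noteq> 0}"
  have IG: "c i \<in> G" if v: "v \<in> G" and i: "i \<in> ?I v" for v i
  proof (rule ccontr)
    assume "c i \<notin> G"
    then have "?T c \<subset> ?T (c(i := v))" using v i by auto
    then have "card (?T c) < card (?T (c(i := v)))" using finP by (intro psubset_card_mono) auto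
    moreover have "card (?T (c(i := v))) \<le> card (?T c)" using max[of "c(i := v)"] i c by simp
    ultimately show False by simp
  qed
  have card_I: "card (?I v) \<le> 4 * D" if v: "v \<in> G" for v
  proof -
    have "?I v \<subseteq> {i \<in> P. (c(p := v)) i \<in> F \<and> d ((c(p := v))(i := e)) \<noteq> 0}"
    proof
      fix i assume i: "i \<in> ?I v"
      then have "d (c(p := v, i := e)) = - d (c(p := e, i := v))" using p by (intro swap) auto
      moreover have "c(p := e, i := v) = c(i := v)" using c(2) by auto
      moreover have "c i \<in> F" using IG[OF v i] G by blast
      ultimately show "i \<in> {i \<in> P. (c(p := v)) i \<in> F \<and> d ((c(p := v))(i := e)) \<noteq> 0}"
        using i by simp
    qed
    then have "card (?I v) \<le> card {i \<in> P. (c(p := v)) i \<in> F \<and> d ((c(p := v))(i := e)) \<noteq> 0}"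
      using finP by (intro card_mono) auto
    also have "\<dots> \<le> 4 * D"
      unfolding F_def \<tau>_def by (rule card_fibre_positions_le[of b p e, OF b p])
    finally show ?thesis .
  qed
  have S: "insert p (?I v) \<subseteq> P" "card (insert p (?I v)) \<le> r" if v: "v \<in> G" for v
    using p card_I[OF v] r finP by (auto simp: card_insert_if)
  have supp: "d (c(k := v)) = 0" if "k \<in> P - insert p (?I v)" for v k using that by blast
  have single: "i = j" if v: "v \<in> G" and i: "i \<in> ?I v" and j: "j \<in> ?I v" for v i j
  proof (rule ccontr)
    assume "i \<noteq> j"
    with i j v show False
      using unimodular_no_long_fibre_circuit[of r c p e "insert p (?I v)" i j v,
          OF U c S[OF v] _ _ _ _ _ _ supp] IG[OF v i] IG[OF v j] G
      unfolding F_def \<tau>_def by blast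
  qed
  have "\<exists>i. i \<in> ?I v" if v: "v \<in> G" for v
  proof (rule ccontr)
    assume none: "\<nexists>i. i \<in> ?I v"
    interpret C: pluecker "P - {p}" "contract p e d" D
      using pluecker_contract[of p b e] b p by (metis fun_upd_triv)
    have upd: "c(i := v, p := e) = c(i := v)" "b(i := v, p := e) = b(i := v)" "c(p := e) = c"
      if "i \<in> P - {p}" for i using that c(2) b(2) by auto
    obtain i where i: "i \<in> P - {p}" "d (b(i := v)) \<noteq> 0" using nonloop[OF v] by (rule bexE)
    have "contract p e d (b(i := v)) = 0"
    proof (rule C.loop[OF _ _ i(1)])
      show "contract p e d c \<noteq> 0" using c(1) upd(3)[OF i(1)] by (simp add: contract_def)
      show "contract p e d (c(k := v)) = 0" if "k \<in> P - {p}" for k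
        using none that upd(1)[OF that] by (auto simp: contract_def)
    qed
    then show False using i upd(2)[OF i(1)] by (simp add: contract_def)
  qed
  then obtain \<iota> where \<iota>: "\<And>v. v \<in> G \<Longrightarrow> \<iota> v \<in> ?I v" by metis
  \<comment> \<open>The basis position and the sign determine \<open>v\<close> modulo
    \<open>e\<close>, which gives the factor 2.\<close>
  let ?\<kappa> = "\<lambda>v. (\<iota> v, d (c(\<iota> v := v)))"
  have sub: "?\<kappa> ` G \<subseteq> (P - {p}) \<times> {d c, - d c}"
  proof
    fix z assume "z \<in> ?\<kappa> ` G"
    then obtain v where v: "v \<in> G" "z = ?\<kappa> v" by blast
    have "d (c(\<iota> v := v)) \<in> {0, d c, - d c}"
      using unimodularD[OF U c(1) S[OF v(1)] _ supp] \<iota>[OF v(1)] by blast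
    then show "z \<in> (P - {p}) \<times> {d c, - d c}" using \<iota>[OF v(1)] v(2) by auto
  qed
  have fin: "finite ((P - {p}) \<times> {d c, - d c})" using finP by simp
  have "card (\<tau> ` G) \<le> card (?\<kappa> ` G)"
  proof (rule card_image_coarser)
    show "finite (?\<kappa> ` G)" using sub fin by (rule finite_subset)
    fix v w assume vw: "v \<in> G" "w \<in> G" and eq: "?\<kappa> v = ?\<kappa> w"
    show "\<tau> v = \<tau> w" unfolding \<tau>_def sig_contract_eq_iff[of c p e, OF c p]
    proof
      fix k assume k: "k \<in> P - {p}"
      show "d (c(k := v)) = d (c(k := w))"
      proof (cases "k = \<iota> v")
        case True
        from eq have "\<iota> v = \<iota> w" "d (c(\<iota> v := v)) = d (c(\<iota> w := w))" by auto
        then show ?thesis by (simp only: True)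
      next
        case False
        then have "k \<notin> ?I v" "k \<notin> ?I w"
          using single[OF vw(1) _ \<iota>[OF vw(1)]] single[OF vw(2) _ \<iota>[OF vw(2)]] eq by auto
        then show ?thesis using k by simp
      qed
    qed
  qed
  also have "\<dots> \<le> card ((P - {p}) \<times> {d c, - d c})" using fin sub by (rule card_mono)
  also have "\<dots> = card (P - {p}) * card {d c, - d c}" by (rule card_cartesian_product)
  also have "\<dots> \<le> card (P - {p}) * 2" by (intro mult_left_mono) (auto simp: card_insert_if)
  finally show ?thesis by simp
qed

text \<open>The multiples of \<open>e\<close> form at most three classes and become one, a loss of
  2. Every other fibre has at most two classes, and at most \<open>2 * card (P - {p})\<close> of
  these fibres are nontrivial. The losses add up to \<open>2 * card P\<close>.\<close>

lemma (in pluecker) unimodular_contract_loss: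
  assumes U: "unimodular r" and r: "4 * D + 1 \<le> r" and b: "d b \<noteq> 0" "b p = e" and p: "p \<in> P"
  defines "\<tau> \<equiv> sig (P - {p}) (contract p e d)"
  shows "card (range (sig P d)) \<le> card (range \<tau>) + 2 * card P"
proof -
  have r2: "2 \<le> r" using r b(1) bound[of b] by simp
  have same: "d (h(k := x)) = d (h(k := z))" if "\<tau> x = \<tau> z" "h p = e" "k \<in> P - {p}" for x z h k
    using sig_contractD[of p e x z h k, OF that(1)[unfolded \<tau>_def] that(2,3)] .
  let ?X = "{x. \<exists>i\<in>P - {p}. d (b(i := x)) \<noteq> 0}"
  have loops: "card (sig P d ` (- ?X)) \<le> 3"
  proof -
    have "card (sig P d ` (- ?X)) \<le> card {0, d b, - d b}"
    proof (rule card_fibre[of b p e, OF b p])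
      show "sig (P - {p}) (contract p e d) x = sig (P - {p}) (contract p e d) y"
        if "x \<in> - ?X" "y \<in> - ?X" for x y
        unfolding sig_contract_eq_iff[of b p e, OF b p] using that by simp
      show "d (b(p := x)) \<in> {0, d b, - d b}" if "x \<in> - ?X" for x
        using that r p by (intro unimodularD[OF U b(1), of "{p}"]) auto
    qed auto
    also have "\<dots> \<le> 3" by (simp add: card_insert_if)
    finally show ?thesis .
  qed
  have fibres: "card (sig P d ` {y \<in> ?X. \<tau> y = \<tau> x}) \<le> Suc 1" if x: "x \<in> ?X" for x
  proof -
    from x obtain i where i: "i \<in> P - {p}" and nz: "d (b(i := x)) \<noteq> 0" by auto
    define f where "f = b(i := x)"
    have f: "d f \<noteq> 0" "f p = e" "f i = x" using nz b i by (auto simp: f_def)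
    let ?Y = "{y \<in> ?X. \<tau> y = \<tau> x}"
    have fj: "d (f(j := y)) = 0" if "j \<in> P - {i, p}" "\<tau> y = \<tau> x" for j y
    proof -
      have "d (f(j := y)) = d (f(j := x))" using that f by (intro same) auto
      also have "\<dots> = 0" using repeated[of i j "f(j := x)"] that i f by simp
      finally show ?thesis .
    qed
    have val: "d (f(p := y)) \<in> {0, d f, - d f}" if "y \<in> ?Y" for y
      using that i p r2 fj by (intro unimodularD[OF U f(1), of "{i, p}"]) auto
    \<comment> \<open>Such elements satisfy \<open>z = y - 2e\<close>, so \<open>z\<close> would
      have the coefficient -2 in the basis \<open>g\<close> through \<open>y\<close> and
      \<open>e\<close>.\<close>
    have not_both: False if y: "y \<in> ?Y" "z \<in> ?Y" "d (f(p := y)) = d f" "d (f(p := z)) = - d f" for y z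
    proof -
      define g where "g = f(i := y)"
      have "d g = d (f(i := x))" unfolding g_def using y f i by (intro same) auto
      also have "f(i := x) = f" using f by auto
      finally have dg: "d g = d f" .
      have g: "g p = e" "g i = y" using f i by (auto simp: g_def)
      have eq: "\<tau> y = \<tau> z" using y by simp
      have "d (g(p := y)) = 0" using repeated[of i p "g(p := y)"] g i p by simp
      moreover have "g(p := e) = g" using g by auto
      ultimately have "d f * d (g(p := z)) = d f * (- 2 * d f)"
        using partner[of f p e, OF f(2) p p eq[unfolded \<tau>_def], of g] y dg by simp
      then have "d (g(p := z)) = - 2 * d f" by (simp only: mult_left_cancel[OF f(1)])
      moreover have "d (g(p := z)) \<in> {0, d g, - d g}"
      proof (rule unimodularD[OF U, of g "{i, p}"])
        fix j assume j: "j \<in> P - {i, p}"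
        have "d (g(j := z)) = d (g(j := y))" using j g eq by (intro same) auto
        also have "\<dots> = 0" using repeated[of i j "g(j := y)"] j i g by simp
        finally show "d (g(j := z)) = 0" .
      qed (use f dg i p r2 in auto)
      ultimately show False using dg f(1) by auto
    qed
    have "\<exists>V. finite V \<and> card V \<le> 2 \<and> (\<forall>y\<in>?Y. d (f(p := y)) \<in> V)"
    proof (cases "\<exists>y\<in>?Y. d (f(p := y)) = d f")
      case True
      then have "\<forall>y\<in>?Y. d (f(p := y)) \<in> {0, d f}" using not_both val by blast
      then show ?thesis by (intro exI[of _ "{0, d f}"]) (simp add: card_insert_if)
    next
      case False
      then have "\<forall>y\<in>?Y. d (f(p := y)) \<in> {0, - d f}" using val by blast
      then show ?thesis by (intro exI[of _ "{0, - d f}"]) (simp add: card_insert_if)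
    qed
    then obtain V where V: "finite V" "card V \<le> 2" "\<And>y. y \<in> ?Y \<Longrightarrow> d (f(p := y)) \<in> V" by blast
    have "card (sig P d ` ?Y) \<le> card V"
      by (rule card_fibre[of f p e, OF f(1,2) p _ V(1,3)]) (auto simp: \<tau>_def)
    then show ?thesis using V(2) by simp
  qed
  let ?G = "{x \<in> ?X. \<exists>y\<in>?X. \<tau> y = \<tau> x \<and> sig P d y \<noteq> sig P d x}"
  have G: "card (\<tau> ` ?G) \<le> 2 * card (P - {p})"
    unfolding \<tau>_def by (rule card_unimodular_fibres_le[of r b p e, OF U r b p]) auto
  have X: "card (sig P d ` ?X) \<le> card (\<tau> ` ?X) + 1 * card (\<tau> ` ?G)"
  proof (rule card_image_le_fibres[OF finite_sig _ fibres])
    show "\<tau> x = \<tau> y" if "sig P d x = sig P d y" for x y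
      unfolding \<tau>_def using sig_imp_sig_contract[OF p that] .
  qed
  interpret C: pluecker "P - {p}" "contract p e d" D
    using pluecker_contract[of p b e] b p by (metis fun_upd_triv)
  have fin: "finite (\<tau> ` A)" for A unfolding \<tau>_def by (rule C.finite_sig)
  \<comment> \<open>The class of \<open>e\<close> is that of the loops of the contraction; not being
    counted in \<open>?X\<close>, it offsets one of the three classes in
    \<open>loops\<close>.\<close>
  have "\<tau> e \<notin> \<tau> ` ?X"
  proof
    assume "\<tau> e \<in> \<tau> ` ?X"
    then obtain x i where x: "\<tau> e = \<tau> x" and i: "i \<in> P - {p}" and nz: "d (b(i := x)) \<noteq> 0" by auto
    have "d (b(i := e)) = 0" using repeated[of p i "b(i := e)"] i p b by simp
    then show False using nz same[of e x b i, OF x b(2) i] by simp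
  qed
  then have "Suc (card (\<tau> ` ?X)) = card (insert (\<tau> e) (\<tau> ` ?X))" using fin by simp
  also have "\<dots> \<le> card (range \<tau>)" using fin by (intro card_mono) auto
  finally have range: "Suc (card (\<tau> ` ?X)) \<le> card (range \<tau>)" .
  have "range (sig P d) = sig P d ` (- ?X) \<union> sig P d ` ?X" by blast
  then have "card (range (sig P d)) \<le> card (sig P d ` (- ?X)) + card (sig P d ` ?X)"
    by (simp only: card_Un_le)
  moreover have "card P = Suc (card (P - {p}))" using p finP by (metis card_Suc_Diff1)
  ultimately show ?thesis using loops X G range by linarith
qed

section \<open>The double induction on the bound and the rank\<close>

text \<open>While small circuits are unimodular, each contraction costs \<open>2 * card P\<close>,
  which sums to the square. The first failure lowers \<open>D\<close> at a linear cost, to be paid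
  once for each value of \<open>D\<close> and thus absorbed into \<open>c\<close>. For
  \<open>D = 0\<close> there is no such function.\<close>

theorem card_sig_bound:
  "\<exists>c. \<forall>P (d :: (nat \<Rightarrow> 'a) \<Rightarrow> int). pluecker P d D \<longrightarrow>
     card (range (sig P d)) \<le> (card P)\<^sup>2 + c * card P + 1"
proof (induction D)
  case 0
  have "\<not> pluecker P d 0" for P and d :: "(nat \<Rightarrow> 'a) \<Rightarrow> int"
  proof
    assume "pluecker P d 0"
    then interpret pluecker P d 0 .
    show False using bound nonzero by auto
  qed
  then show ?case by blast
next
  case (Suc D)
  then obtain c where c: "\<And>P d :: (nat \<Rightarrow> 'a) \<Rightarrow> int. pluecker P d D \<Longrightarrow>
    card (range (sig P d)) \<le> (card P)\<^sup>2 + c * card P + 1" by blast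
  let ?r = "4 * Suc D + 1"
  \<comment> \<open>The final \<open>+ 1\<close> covers the excess of the cost
    \<open>2 * Suc m\<close> over the increase \<open>2 * m + 1\<close> of the square.\<close>
  let ?c = "c + ?r * loss (Suc D) + 1"
  have "card (range (sig P d)) \<le> (card P)\<^sup>2 + ?c * card P + 1"
    if "pluecker P d (Suc D)" for P and d :: "(nat \<Rightarrow> 'a) \<Rightarrow> int"
    using that
  proof (induction "card P" arbitrary: P d)
    case 0
    then have "P = {}" by (simp add: pluecker.finP)
    then have "range (sig P d) \<subseteq> {\<lambda>_. 0}" by (auto simp: sig_def)
    then have "card (range (sig P d)) \<le> card {\<lambda>_ :: nat \<times> (nat \<Rightarrow> 'a). 0 :: int}"
      by (intro card_mono) auto
    then show ?case by simp
  next
    case (Suc m)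
    interpret pluecker P d "Suc D" by fact
    show ?case
    proof (cases "unimodular ?r")
      case True
      obtain p where p: "p \<in> P" using Suc.hyps(2) by fastforce
      obtain b where b: "d b \<noteq> 0" using nonzero by blast
      let ?d = "contract p (b p) d"
      have m: "m = card (P - {p})" using Suc.hyps(2) p finP by simp
      have "card (range (sig (P - {p}) ?d)) \<le> (card (P - {p}))\<^sup>2 + ?c * card (P - {p}) + 1"
        using pluecker_contract[of p b "b p"] p b by (intro Suc.hyps(1) m) simp
      moreover have "card (range (sig P d)) \<le> card (range (sig (P - {p}) ?d)) + 2 * card P"
        using unimodular_contract_loss[OF True _ b refl p] by simp
      ultimately have "card (range (sig P d)) \<le> m\<^sup>2 + ?c * m + 1 + 2 * Suc m"
        using Suc.hyps(2) m by simp
      also have "\<dots> \<le> (Suc m)\<^sup>2 + ?c * Suc m + 1"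
        by (simp add: power2_eq_square)
      finally show ?thesis using Suc.hyps(2) by simp
    next
      case False
      obtain P' and d' :: "(nat \<Rightarrow> 'a) \<Rightarrow> int" where d': "pluecker P' d' D" and le: "card P' \<le> card P"
        and "card (range (sig P d)) \<le> card (range (sig P' d')) + ?r * (loss (Suc D) * card P)"
        using not_unimodular_contract[OF False] by auto
      moreover have "card (range (sig P' d')) \<le> (card P')\<^sup>2 + c * card P' + 1" by (rule c[OF d'])
      moreover have "(card P')\<^sup>2 + c * card P' \<le> (card P)\<^sup>2 + c * card P"
        using le by (intro add_mono power_mono mult_left_mono) auto
      moreover have "?c * card P = c * card P + ?r * (loss (Suc D) * card P) + card P"
        by (simp only: distrib_right mult.assoc mult_1)
      ultimately show ?thesis by linarith
    qed
  qed
  then show ?case by blast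
qed

section \<open>Determinants of rows of a matrix\<close>

text \<open>Rows are functions, so that replacing a row is a function update, as in the
  locale.\<close>

definition rdet :: "nat \<Rightarrow> (nat \<Rightarrow> nat \<Rightarrow> 'a :: comm_ring_1) \<Rightarrow> 'a" where
  "rdet m f = det (mat m m (\<lambda>(i, j). f i j))"

abbreviation rcof :: "nat \<Rightarrow> (nat \<Rightarrow> nat \<Rightarrow> 'a :: comm_ring_1) \<Rightarrow> nat \<Rightarrow> nat \<Rightarrow> 'a" where
  "rcof m f \<equiv> cofactor (mat m m (\<lambda>(i, j). f i j))"

lemma rdet_laplace:
  assumes "k < m"
  shows "rdet m (f(k := x)) = (\<Sum>j<m. x j * rcof m f k j)"
proof -
  let ?A = "mat m m (\<lambda>(i, j). f i j)" and ?B = "mat m m (\<lambda>(i, j). (f(k := x)) i j)"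
  have "mat_delete ?B k j = mat_delete ?A k j" if "j < m" for j
    using that assms by (intro eq_matI) (auto simp: mat_delete_def)
  then have cof: "cofactor ?B k j = cofactor ?A k j" if "j < m" for j
    using that by (simp add: cofactor_def)
  have "det ?B = (\<Sum>j<m. ?B $$ (k, j) * cofactor ?B k j)"
    using assms by (intro laplace_expansion_row) auto
  also have "\<dots> = (\<Sum>j<m. x j * cofactor ?A k j)"
  proof (rule sum.cong[OF refl])
    fix j assume "j \<in> {..<m}"
    then have j: "j < m" by simp
    then have "?B $$ (k, j) = x j" using assms by simp
    then show "?B $$ (k, j) * cofactor ?B k j = x j * cofactor ?A k j" by (simp only: cof[OF j])
  qed
  finally show ?thesis unfolding rdet_def .
qed

text \<open>Cramer's rule, from the product of the adjugate with the matrix.\<close>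

lemma rdet_cramer:
  assumes "j < m"
  shows "(\<Sum>i<m. rdet m (b(i := x)) * b i j) = rdet m b * x j"
proof -
  let ?A = "mat m m (\<lambda>(i, j). b i j)"
  have A: "?A \<in> carrier_mat m m" by simp
  have adj: "(\<Sum>i<m. rcof m b i l * b i j) = (if l = j then rdet m b else 0)" if "l < m" for l
  proof -
    have "(adj_mat ?A * ?A) $$ (l, j) = (\<Sum>i<m. rcof m b i l * b i j)"
      using that assms by (simp add: adj_mat_def scalar_prod_def lessThan_atLeast0)
    moreover have "(adj_mat ?A * ?A) $$ (l, j) = (if l = j then rdet m b else 0)"
      unfolding adj_mat(3)[OF A] rdet_def using that assms by simp
    ultimately show ?thesis by simp
  qed
  have "(\<Sum>i<m. rdet m (b(i := x)) * b i j) = (\<Sum>i<m. \<Sum>l<m. x l * (rcof m b i l * b i j))"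
    by (intro sum.cong refl) (simp add: rdet_laplace sum_distrib_right mult.assoc)
  also have "\<dots> = (\<Sum>l<m. x l * (\<Sum>i<m. rcof m b i l * b i j))"
    by (subst sum.swap) (simp add: sum_distrib_left)
  also have "\<dots> = (\<Sum>l<m. if l = j then x j * rdet m b else 0)"
    using adj by (intro sum.cong) auto
  also have "\<dots> = rdet m b * x j" using assms by (simp add: mult.commute)
  finally show ?thesis .
qed

text \<open>Expand along row \<open>k\<close> and substitute Cramer's rule for
  \<open>rdet m b * x j\<close>.\<close>

lemma rdet_exchange:
  assumes "k < m"
  shows "rdet m b * rdet m (f(k := x)) = (\<Sum>i<m. rdet m (b(i := x)) * rdet m (f(k := b i)))"
proof -
  have "rdet m b * rdet m (f(k := x)) = (\<Sum>j<m. (rdet m b * x j) * rcof m f k j)"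
    unfolding rdet_laplace[OF assms] by (simp add: sum_distrib_left mult.assoc)
  also have "\<dots> = (\<Sum>j<m. \<Sum>i<m. rdet m (b(i := x)) * (b i j * rcof m f k j))"
  proof (rule sum.cong[OF refl])
    fix j assume "j \<in> {..<m}"
    then have j: "j < m" by simp
    show "rdet m b * x j * rcof m f k j = (\<Sum>i<m. rdet m (b(i := x)) * (b i j * rcof m f k j))"
      unfolding rdet_cramer[OF j, of b x, symmetric] by (simp add: sum_distrib_right mult.assoc)
  qed
  also have "\<dots> = (\<Sum>i<m. rdet m (b(i := x)) * rdet m (f(k := b i)))"
    unfolding rdet_laplace[OF assms] by (subst sum.swap) (simp add: sum_distrib_left)
  finally show ?thesis .
qed

lemma rdet_swap:
  assumes "i < m" "j < m" "i \<noteq> j"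
  shows "rdet m (f(i := f j, j := f i)) = - rdet m f"
proof -
  have "mat m m (\<lambda>(k, l). (f(i := f j, j := f i)) k l) = swaprows i j (mat m m (\<lambda>(k, l). f k l))"
    using assms by (intro eq_matI) auto
  then show ?thesis unfolding rdet_def by (simp only: det_swaprows[OF assms mat_carrier])
qed

text \<open>Start from the identity matrix and exchange its rows for rows \<open>R x\<close> as long as possible; a
  row that cannot be exchanged would have its cofactor vector in the kernel of \<open>R\<close>.\<close>

lemma rdet_nonzero_exists:
  fixes R :: "'b \<Rightarrow> nat \<Rightarrow> int"
  assumes "\<And>v. (\<And>x. (\<Sum>j<m. R x j * v j) = 0) \<Longrightarrow> \<forall>j<m. v j = 0"
  shows "\<exists>f. rdet m (\<lambda>i. R (f i)) \<noteq> 0"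
proof -
  let ?T = "\<lambda>g. {i. i < m \<and> g i \<in> range R}"
  let ?u = "\<lambda>i j :: nat. if i = j then 1 else 0 :: int"
  have "mat m m (\<lambda>(i, j). ?u i j) = 1\<^sub>m m" by (intro eq_matI) auto
  then have u: "rdet m ?u \<noteq> 0" by (simp add: rdet_def)
  have "\<exists>g. rdet m g \<noteq> 0 \<and> (\<forall>g'. rdet m g' \<noteq> 0 \<longrightarrow> card (?T g') \<le> card (?T g))"
  proof (rule ex_has_greatest_nat[where k = ?u and b = "Suc m"])
    have "card (?T g) \<le> card {..<m}" for g by (intro card_mono) auto
    then show "\<forall>g. rdet m g \<noteq> 0 \<longrightarrow> card (?T g) < Suc m" by (simp add: less_Suc_eq_le)
  qed (rule u)
  then obtain g where g: "rdet m g \<noteq> 0"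
    and max: "\<And>g'. rdet m g' \<noteq> 0 \<Longrightarrow> card (?T g') \<le> card (?T g)" by blast
  have "g i \<in> range R" if i: "i < m" for i
  proof (rule ccontr)
    assume ni: "g i \<notin> range R"
    have "(\<Sum>j<m. R x j * rcof m g i j) = 0" for x
    proof (rule ccontr)
      assume "(\<Sum>j<m. R x j * rcof m g i j) \<noteq> 0"
      then have "rdet m (g(i := R x)) \<noteq> 0" unfolding rdet_laplace[OF i] .
      from max[OF this] have "card (?T (g(i := R x))) \<le> card (?T g)" .
      moreover have "?T g \<subset> ?T (g(i := R x))" using i ni by auto
      then have "card (?T g) < card (?T (g(i := R x)))" by (intro psubset_card_mono) auto
      ultimately show False by simp
    qed
    then have "\<forall>j<m. rcof m g i j = 0" by (rule assms)
    then have "rdet m (g(i := g i)) = 0" unfolding rdet_laplace[OF i] by simp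
    then show False using g by simp
  qed
  then have "\<forall>i. \<exists>x. i < m \<longrightarrow> g i = R x" by auto
  then obtain f where f: "\<And>i. i < m \<Longrightarrow> g i = R (f i)" by metis
  have "mat m m (\<lambda>(i, j). g i j) = mat m m (\<lambda>(i, j). R (f i) j)" using f by (intro eq_matI) auto
  then have "rdet m (\<lambda>i. R (f i)) = rdet m g" by (simp add: rdet_def)
  then show ?thesis using g by metis
qed

section \<open>A column basis and its determinants\<close>

lemma (in vec_space) lin_dep_iff_sum:
  assumes fin: "finite S" and S: "S \<subseteq> carrier_vec n"
  shows "lin_dep S \<longleftrightarrow> (\<exists>a. (\<exists>s\<in>S. a s \<noteq> 0) \<and> (\<forall>x<n. (\<Sum>s\<in>S. a s * s $ x) = 0))"
proof
  assume "lin_dep S"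
  then obtain a s where a: "lincomb a S = 0\<^sub>v n" "s \<in> S" "a s \<noteq> 0"
    using finite_lin_dep[OF fin] S by auto
  have "(\<Sum>s\<in>S. a s * s $ x) = 0" if "x < n" for x
    using lincomb_index[OF that S, where a = a] a(1) that by simp
  then show "\<exists>a. (\<exists>s\<in>S. a s \<noteq> 0) \<and> (\<forall>x<n. (\<Sum>s\<in>S. a s * s $ x) = 0)" using a by blast
next
  assume "\<exists>a. (\<exists>s\<in>S. a s \<noteq> 0) \<and> (\<forall>x<n. (\<Sum>s\<in>S. a s * s $ x) = 0)"
  then obtain a s where s: "s \<in> S" "a s \<noteq> 0" and a: "\<And>x. x < n \<Longrightarrow> (\<Sum>s\<in>S. a s * s $ x) = 0"
    by blast
  have "lincomb a S = 0\<^sub>v n"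
    using lincomb_index[OF _ S, where a = a] a lincomb_dim[OF fin S]
    by (intro eq_vecI) auto
  then show "lin_dep S" using lin_dep_crit[OF fin subset_refl, where a = a and v = s] s by auto
qed

lemma pick_bij_betw:
  assumes "finite J"
  shows "bij_betw (pick J) {..<card J} J"
proof (rule bij_betwI')
  show "(pick J x = pick J y) = (x = y)" if "x \<in> {..<card J}" "y \<in> {..<card J}" for x y
    using that pick_mono_le[of x J y] pick_mono_le[of y J x]
    by (metis lessThan_iff linorder_neqE_nat less_irrefl)
  show "pick J x \<in> J" if "x \<in> {..<card J}" for x using that pick_in_set_le by simp
  show "\<exists>x\<in>{..<card J}. y = pick J x" if "y \<in> J" for y
  proof
    show "y = pick J (card {a \<in> J. a < y})" using pick_card_in_set[OF that] by simp
    show "card {a \<in> J. a < y} \<in> {..<card J}"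
      using that assms by (auto intro!: psubset_card_mono)
  qed
qed

text \<open>A maximal independent set of columns has as many elements as the rank. Independence
  gives the trivial kernel; since all columns are combinations of the chosen ones, rows that agree
  on these agree everywhere.\<close>

lemma column_basis:
  fixes A :: "int mat"
  defines "n \<equiv> dim_row A" and "m \<equiv> int_rank A"
  obtains J where "J \<subseteq> {..<dim_col A}" "card J = m"
    "\<And>v. (\<And>x. x < n \<Longrightarrow> (\<Sum>j<m. A $$ (x, pick J j) * v j) = 0) \<Longrightarrow> \<forall>j<m. v j = 0"
    "\<And>x y. x < n \<Longrightarrow> y < n \<Longrightarrow> (\<And>j. j < m \<Longrightarrow> A $$ (x, pick J j) = A $$ (y, pick J j)) \<Longrightarrow> row A x = row A y"
proof -
  let ?Q = "map_mat rat_of_int A"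
  interpret vec_space "TYPE(rat)" n .
  let ?C = "set (cols ?Q)"
  have Q: "?Q \<in> carrier_mat n (dim_col A)" by (simp add: n_def)
  have C: "?C \<subseteq> carrier_vec n" using cols_dim[of ?Q] Q by auto
  have Cimg: "?C = col ?Q ` {..<dim_col A}" by (auto simp: cols_def)
  have "\<exists>S. finite S \<and> maximal S (\<lambda>T. T \<subseteq> ?C \<and> lin_indpt T) \<and> {} \<subseteq> S"
    by (rule maximal_exists_superset[of ?C]) (auto simp: lin_dep_def)
  then obtain S where finS: "finite S" and max: "maximal S (\<lambda>T. T \<subseteq> ?C \<and> lin_indpt T)" by blast
  have SC: "S \<subseteq> ?C" and ind: "lin_indpt S" using max unfolding maximal_def by auto
  have Sn: "S \<subseteq> carrier_vec n" using SC C by blast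
  have cardS: "card S = m" using rank_card_indpt[OF Q max] by (simp add: m_def int_rank_def n_def)
  \<comment> \<open>A matrix may repeat columns, so one index is chosen for each member of
    \<open>S\<close>.\<close>
  obtain J where J: "J \<subseteq> {..<dim_col A}" "inj_on (col ?Q) J" "S = col ?Q ` J"
    using SC unfolding Cimg subset_image_inj by blast
  have finJ: "finite J" using J(1) finite_subset by blast
  have cardJ: "card J = m" using J cardS card_image by metis
  let ?\<phi> = "\<lambda>j. col ?Q (pick J j)"
  have bijJ: "bij_betw (pick J) {..<m} J" using pick_bij_betw[OF finJ] cardJ by simp
  then have bij: "bij_betw ?\<phi> {..<m} S"
    using bij_betw_trans[OF bijJ inj_on_imp_bij_betw[OF J(2)]] J(3) by (simp add: comp_def)
  have entry: "?\<phi> j $ x = rat_of_int (A $$ (x, pick J j))" if "j < m" "x < n" for j x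
    using that bij_betwE[OF bijJ] J(1) by (auto simp: n_def)
  have kernel: "\<forall>j<m. v j = 0"
    if v: "\<And>x. x < n \<Longrightarrow> (\<Sum>j<m. A $$ (x, pick J j) * v j) = 0" for v
  proof (rule ccontr)
    assume "\<not> (\<forall>j<m. v j = 0)"
    then obtain j where j: "j < m" "v j \<noteq> 0" by blast
    let ?a = "\<lambda>s. rat_of_int (v (inv_into {..<m} ?\<phi> s))"
    have inv: "inv_into {..<m} ?\<phi> (?\<phi> k) = k" if "k < m" for k
      using that bij by (intro inv_into_f_f) (auto simp: bij_betw_def)
    have "(\<Sum>s\<in>S. ?a s * s $ x) = 0" if x: "x < n" for x
    proof -
      have "(\<Sum>s\<in>S. ?a s * s $ x) = (\<Sum>k<m. ?a (?\<phi> k) * ?\<phi> k $ x)"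
        by (rule sum.reindex_bij_betw[OF bij, symmetric])
      also have "\<dots> = (\<Sum>k<m. rat_of_int (A $$ (x, pick J k) * v k))"
        using x by (intro sum.cong refl) (simp add: inv entry del: index_col)
      also have "\<dots> = 0" unfolding of_int_sum[symmetric] v[OF x] by simp
      finally show ?thesis .
    qed
    moreover have "?\<phi> j \<in> S" "?a (?\<phi> j) \<noteq> 0" using j inv bij_betwE[OF bij] by auto
    ultimately have "lin_dep S" using lin_dep_iff_sum[OF finS Sn] by metis
    then show False using ind by simp
  qed
  have rows: "row A x = row A y"
    if xy: "x < n" "y < n" and eq: "\<And>j. j < m \<Longrightarrow> A $$ (x, pick J j) = A $$ (y, pick J j)" for x y
  proof (rule eq_vecI)
    fix l assume "l < dim_vec (row A y)"
    then have l: "l < dim_col A" by simp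
    let ?c = "col ?Q l"
    have c: "?c \<in> ?C" using l unfolding Cimg by blast
    have Seq: "s $ x = s $ y" if s: "s \<in> S" for s
    proof -
      obtain j where j: "j < m" "s = ?\<phi> j" using s bij unfolding bij_betw_def by auto
      then show ?thesis using entry[OF j(1) xy(1)] entry[OF j(1) xy(2)] eq[OF j(1)] by simp
    qed
    have "?c $ x = ?c $ y"
    proof (cases "?c \<in> S")
      case False
      have "lin_dep (insert ?c S)"
        using max False c SC unfolding maximal_def by blast
      then obtain a where a: "\<exists>s\<in>insert ?c S. a s \<noteq> 0"
        and sum0: "\<And>z. z < n \<Longrightarrow> (\<Sum>s\<in>insert ?c S. a s * s $ z) = 0"
        using lin_dep_iff_sum[of "insert ?c S"] finS Sn c C by auto
      have split: "a ?c * ?c $ z + (\<Sum>s\<in>S. a s * s $ z) = 0" if "z < n" for z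
        using sum0[OF that] sum.insert[OF finS False, of "\<lambda>s. a s * s $ z"] by simp
      have "a ?c \<noteq> 0"
      proof
        assume 0: "a ?c = 0"
        have "(\<Sum>s\<in>S. a s * s $ z) = 0" if "z < n" for z using split[OF that] 0 by simp
        moreover have "\<exists>s\<in>S. a s \<noteq> 0" using a 0 by blast
        ultimately have "lin_dep S" using lin_dep_iff_sum[OF finS Sn] by metis
        then show False using ind by simp
      qed
      moreover have "(\<Sum>s\<in>S. a s * s $ x) = (\<Sum>s\<in>S. a s * s $ y)"
        using Seq by (intro sum.cong) auto
      then have "a ?c * ?c $ x = a ?c * ?c $ y" using split[OF xy(1)] split[OF xy(2)] by linarith
      ultimately show ?thesis by simp
    qed (rule Seq)
    then show "row A x $ l = row A y $ l" using xy l by (simp add: n_def)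
  qed simp
  show thesis using that[OF J(1) cardJ kernel rows] by blast
qed

text \<open>A repeated row makes the determinant 0; otherwise sorting the rows, at the cost of a
  sign, produces a \<open>submatrix\<close>, whose rows come in increasing order.\<close>

lemma abs_rdet_rows_le:
  fixes A :: "int mat"
  assumes \<Delta>: "delta_modular \<Delta> A" "0 \<le> \<Delta>" and J: "J \<subseteq> {..<dim_col A}" "card J = int_rank A"
    and g: "\<And>i. i < int_rank A \<Longrightarrow> g i < dim_row A"
  shows "\<bar>rdet (int_rank A) (\<lambda>i j. A $$ (g i, pick J j))\<bar> \<le> \<Delta>"
proof -
  let ?m = "int_rank A"
  let ?M = "mat ?m ?m (\<lambda>(i, j). A $$ (g i, pick J j))"
  show ?thesis
  proof (cases "inj_on g {..<?m}")
    case False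
    then obtain i k where ik: "i < ?m" "k < ?m" "i \<noteq> k" "g i = g k" by (auto simp: inj_on_def)
    have "row ?M i = row ?M k" using ik by (intro eq_vecI) auto
    then have "det ?M = 0" using ik by (intro det_identical_rows[of ?M ?m i k]) auto
    then show ?thesis using \<Delta> by (simp add: rdet_def)
  next
    case True
    define I where "I = g ` {..<?m}"
    have I: "I \<subseteq> {..<dim_row A}" "card I = ?m" "finite I"
      using g True by (auto simp: I_def card_image)
    \<comment> \<open>This is the position of row \<open>g i\<close> in the sorted submatrix;
      \<open>permutes\<close> demands the identity outside the index range.\<close>
    define p where "p i = (if i < ?m then card {a \<in> I. a < g i} else i)" for i
    have gI: "g i \<in> I" if "i < ?m" for i using that by (simp add: I_def)
    have pick_p: "pick I (p i) = g i" if "i < ?m" for i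
      using that pick_card_in_set[OF gI[OF that]] by (simp add: p_def)
    have p_less: "p i < ?m" if "i < ?m" for i
    proof -
      have "card {a \<in> I. a < g i} < card I" using gI[OF that] I(3) by (intro psubset_card_mono) auto
      then show ?thesis using that I by (simp add: p_def)
    qed
    have "inj_on p {0..<?m}"
      using True pick_p by (auto simp: inj_on_def) (metis lessThan_iff)
    moreover from this have "p ` {0..<?m} = {0..<?m}"
      using p_less by (intro endo_inj_surj) auto
    ultimately have "bij_betw p {0..<?m} {0..<?m}" by (simp add: bij_betw_def)
    then have perm: "p permutes {0..<?m}" by (rule bij_imp_permutes) (simp add: p_def)
    let ?S = "submatrix A I J"
    have dims: "card {i. i < dim_row A \<and> i \<in> I} = ?m" "card {j. j < dim_col A \<and> j \<in> J} = ?m"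
    proof -
      have "{i. i < dim_row A \<and> i \<in> I} = I" "{j. j < dim_col A \<and> j \<in> J} = J" using I(1) J(1) by auto
      then show "card {i. i < dim_row A \<and> i \<in> I} = ?m" "card {j. j < dim_col A \<and> j \<in> J} = ?m"
        using I(2) J(2) by auto
    qed
    have S: "?S \<in> carrier_mat ?m ?m" using dims by (auto simp: dim_submatrix)
    have "?M = mat ?m ?m (\<lambda>(i, j). ?S $$ (p i, j))"
      using pick_p p_less dims by (intro eq_matI) (auto simp: submatrix_index)
    then have "det ?M = signof p * det ?S" using det_permute_rows[OF S perm] by simp
    then have "\<bar>det ?M\<bar> = \<bar>det ?S\<bar>" by (simp add: abs_mult sign_def)
    also have "\<dots> \<le> \<Delta>" using \<Delta>(1) I J unfolding delta_modular_def by blast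
    finally show ?thesis by (simp add: rdet_def)
  qed
qed

lemma pluecker_matrix:
  fixes A :: "int mat" and r :: "'b \<Rightarrow> nat"
  assumes \<Delta>: "delta_modular \<Delta> A" "0 \<le> \<Delta>" and J: "J \<subseteq> {..<dim_col A}" "card J = int_rank A"
    and kernel: "\<And>v. (\<And>x. x < dim_row A \<Longrightarrow> (\<Sum>j<int_rank A. A $$ (x, pick J j) * v j) = 0)
      \<Longrightarrow> \<forall>j<int_rank A. v j = 0"
    and r: "range r = {..<dim_row A}"
  shows "pluecker {..<int_rank A} (\<lambda>f. rdet (int_rank A) (\<lambda>i j. A $$ (r (f i), pick J j))) (nat \<Delta>)"
proof
  let ?m = "int_rank A" and ?R = "\<lambda>x j. A $$ (r x, pick J j)"
  have upd: "(\<lambda>i. ?R ((f(k := x)) i)) = (\<lambda>i. ?R (f i))(k := ?R x)" for f k x by auto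
  show "finite {..<?m}" by simp
  show "rdet ?m (\<lambda>l. ?R ((f(i := f j, j := f i)) l)) = - rdet ?m (\<lambda>l. ?R (f l))"
    if "i \<in> {..<?m}" "j \<in> {..<?m}" "i \<noteq> j" for i j f
  proof -
    have sw: "(\<lambda>l. ?R ((f(i := f j, j := f i)) l)) = (\<lambda>l. ?R (f l))(i := ?R (f j), j := ?R (f i))"
      by auto
    show ?thesis
      unfolding sw by (rule rdet_swap[of i ?m j "\<lambda>l. ?R (f l)"]) (use that in auto)
  qed
  show "rdet ?m (\<lambda>i. ?R (b i)) * rdet ?m (\<lambda>i. ?R ((f(k := x)) i)) =
      (\<Sum>i<?m. rdet ?m (\<lambda>l. ?R ((b(i := x)) l)) * rdet ?m (\<lambda>l. ?R ((f(k := b i)) l)))"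
    if "k \<in> {..<?m}" for k b f x
    unfolding upd using that by (intro rdet_exchange) auto
  show "\<bar>rdet ?m (\<lambda>i. ?R (f i))\<bar> \<le> int (nat \<Delta>)" for f
    using abs_rdet_rows_le[OF \<Delta> J, of "\<lambda>i. r (f i)"] r \<Delta>(2) by auto
  show "\<exists>b. rdet ?m (\<lambda>i. ?R (b i)) \<noteq> 0"
  proof (rule rdet_nonzero_exists[where R = ?R])
    fix v assume v: "\<And>x. (\<Sum>j<?m. ?R x j * v j) = 0"
    show "\<forall>j<?m. v j = 0"
    proof (rule kernel)
      fix x assume "x < dim_row A"
      then obtain y where "x = r y" using r by (metis imageE lessThan_iff)
      then show "(\<Sum>j<?m. A $$ (x, pick J j) * v j) = 0" using v[of y] by simp
    qed
  qed
qed

theorem theorem2p6: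
  fixes \<Delta> :: int
  assumes "\<Delta> > 0"
  shows "\<exists>c::real. \<forall>(m::nat) (A::int mat).
           m > 0 \<longrightarrow> int_rank A = m \<longrightarrow> delta_modular \<Delta> A \<longrightarrow>
           real (card (set (rows A))) \<le> (real m)\<^sup>2 + c * real m"
proof -
  obtain c where c: "\<And>P (d :: (nat \<Rightarrow> nat) \<Rightarrow> int). pluecker P d (nat \<Delta>) \<Longrightarrow>
      card (range (sig P d)) \<le> (card P)\<^sup>2 + c * card P + 1"
    using card_sig_bound by blast
  have "real (card (set (rows A))) \<le> (real m)\<^sup>2 + real (c + 1) * real m"
    if m: "0 < m" "int_rank A = m" and A: "delta_modular \<Delta> A" for m and A :: "int mat"
  proof (cases "dim_row A = 0")
    case True
    then show ?thesis by (simp add: rows_def)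
  next
    case False
    let ?n = "dim_row A"
    \<comment> \<open>Reduction modulo the number of rows lets every natural number name a row, as
      the locale takes tuples over a whole type.\<close>
    define r where "r k = k mod ?n" for k
    have r: "range r = {..<?n}"
    proof
      show "range r \<subseteq> {..<?n}" using False by (auto simp: r_def)
      show "{..<?n} \<subseteq> range r"
      proof
        fix x assume "x \<in> {..<?n}"
        then have "x = r x" by (simp add: r_def)
        then show "x \<in> range r" by (rule range_eqI)
      qed
    qed
    obtain J where J: "J \<subseteq> {..<dim_col A}" "card J = int_rank A"
      and kernel: "\<And>v. (\<And>x. x < ?n \<Longrightarrow> (\<Sum>j<int_rank A. A $$ (x, pick J j) * v j) = 0) \<Longrightarrow>
        \<forall>j<int_rank A. v j = 0"
      and rows: "\<And>x y. x < ?n \<Longrightarrow> y < ?n \<Longrightarrow>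
        (\<And>j. j < int_rank A \<Longrightarrow> A $$ (x, pick J j) = A $$ (y, pick J j)) \<Longrightarrow> row A x = row A y"
      using column_basis[of A] by blast
    let ?R = "\<lambda>x j. A $$ (r x, pick J j)"
    define d where "d f = rdet m (\<lambda>i. ?R (f i))" for f
    interpret pluecker "{..<m}" d "nat \<Delta>"
      unfolding d_def m(2)[symmetric]
      by (rule pluecker_matrix[OF A _ J kernel r]) (use assms in simp)
    \<comment> \<open>Cramer's rule recovers the entries in the basis columns from the coordinates
      in \<open>b\<close>, and these entries determine the row.\<close>
    have eq: "row A (r x) = row A (r y)" if xy: "sig {..<m} d x = sig {..<m} d y" for x y
    proof (rule rows)
      show "r x < ?n" "r y < ?n" using False by (auto simp: r_def)
      fix j assume "j < int_rank A"
      then have j: "j < m" using m by simp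
      obtain b where b: "d b \<noteq> 0" using nonzero by blast
      let ?b = "\<lambda>i. ?R (b i)"
      have upd: "d (b(i := z)) = rdet m (?b(i := ?R z))" for i z
        unfolding d_def by (rule arg_cong[where f = "rdet m"]) auto
      have "rdet m ?b * ?R x j = (\<Sum>i<m. d (b(i := x)) * ?b i j)"
        unfolding upd by (rule rdet_cramer[OF j, symmetric])
      also have "\<dots> = (\<Sum>i<m. d (b(i := y)) * ?b i j)"
        by (intro sum.cong refl) (simp add: sigD[OF xy])
      also have "\<dots> = rdet m ?b * ?R y j" unfolding upd by (rule rdet_cramer[OF j])
      finally show "?R x j = ?R y j" using b by (simp add: d_def)
    qed
    have "set (rows A) = row A ` {..<?n}" by (auto simp: rows_def)
    also have "\<dots> = (\<lambda>x. row A (r x)) ` UNIV" unfolding r[symmetric] by (simp add: image_image)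
    finally have "card (set (rows A)) \<le> card (range (sig {..<m} d))"
      using card_image_coarser[OF finite_sig eq] by simp
    also have "\<dots> \<le> m\<^sup>2 + c * m + 1" using c[OF pluecker_axioms] by simp
    \<comment> \<open>The class of the zero signature is absorbed because \<open>m\<close> is
      positive.\<close>
    also have "\<dots> \<le> m\<^sup>2 + (c + 1) * m" using m(1) by simp
    finally have "real (card (set (rows A))) \<le> real (m\<^sup>2 + (c + 1) * m)" by (simp only: of_nat_le_iff)
    then show ?thesis by (simp add: algebra_simps)
  qed
  then show ?thesis by blast
qed

end
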